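(* The Windows Scheduling Problem (single machine, unit-length jobs, exact periods) can be reduced to the Partial Coding Problem in polynomial time; i.e., there is a polynomial-time algorithm mapping each Windows Scheduling instance to a Partial Coding instance such that the former admits a feasible schedule if and only if the latter admits a feasible encoding.
   Context: Windows Scheduling Problem (single machine, unit-length jobs, exact periods): given positive integers $p_1,\ldots,p_n$ (periods, encoded in binary), decide whether there exist integer start times $t_1,\ldots,t_n$ such that, when job $j$ is executed in exactly the unit time slots $t_j+kp_j$ ($k\in\mathbb{Z}$), no two distinct jobs are executed in the same time slot. Partial Coding Problem: given $d$ attributes with value ranges $f_1,\ldots,f_d$ (integers $\ge 2$) and $n$ symbols $s_1,\ldots,s_n\subseteq\{1,\ldots,d\}$, an encoding of $s_j$ is a map $c_j:s_j\to\mathbb{N}$ with $c_j(i)\in[0,f_i-1]$; encodings $c_1,\ldots,c_n$ are feasible if for every $j\ne k$ there is an attribute $i\in s_j\cap s_k$ with $c_j(i)\ne c_k(i)$. The problem is to decide whether a feasible encoding exists. *)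

theory Defs
  imports "HOL-Library.Log_Nat" "HOL-Computational_Algebra.Polynomial"
begin

section \<open>Random access machines with logarithmic cost\<close>

text \<open>
  Polynomial time is measured on a random access machine over the natural numbers with the
  logarithmic cost criterion, programmed in a structured while language. A program uses finitely
  many array variables; a scalar variable is cell 0 of an array. Every operation is charged the
  bit lengths of all addresses and operands involved. Output is written item by item, so that
  the size of the output never exceeds the running time.
\<close>

type_synonym vname = string
type_synonym store = "vname \<Rightarrow> nat \<Rightarrow> nat"

datatype aexp =
    N nat
  | Cell vname aexp
  | Plus aexp aexp
  | Minus aexp aexp
  | Times aexp aexp
  | Div aexp aexp

text \<open>
  Subtraction is truncated at 0 and the quotient by 0 is 0, as in HOL. Tests use the convention
  that nonzero is true; hence \<open>a < b\<close> is tested by \<open>Minus b a\<close>.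
\<close>

fun aval :: "aexp \<Rightarrow> store \<Rightarrow> nat" where
  "aval (N n) s = n"
| "aval (Cell x i) s = s x (aval i s)"
| "aval (Plus a b) s = aval a s + aval b s"
| "aval (Minus a b) s = aval a s - aval b s"
| "aval (Times a b) s = aval a s * aval b s"
| "aval (Div a b) s = aval a s div aval b s"

text \<open>The number of binary digits, plus one for a separator (so that 0 is not free either).\<close>

definition bits :: "nat \<Rightarrow> nat" where
  "bits n = floorlog 2 n + 1"

fun acost :: "aexp \<Rightarrow> store \<Rightarrow> nat" where
  "acost (N n) s = bits n"
| "acost (Cell x i) s = acost i s + bits (aval i s) + bits (s x (aval i s))"
| "acost (Plus a b) s = acost a s + acost b s + bits (aval a s) + bits (aval b s)"
| "acost (Minus a b) s = acost a s + acost b s + bits (aval a s) + bits (aval b s)"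
| "acost (Times a b) s = acost a s + acost b s + bits (aval a s) + bits (aval b s)"
| "acost (Div a b) s = acost a s + acost b s + bits (aval a s) + bits (aval b s)"

datatype com =
    Skip
  | Assign vname aexp aexp
  | Write aexp
  | Seq com com
  | Cond aexp com com
  | While aexp com

definition upd :: "store \<Rightarrow> vname \<Rightarrow> nat \<Rightarrow> nat \<Rightarrow> store" where
  "upd s x i v = s(x := (s x)(i := v))"

text \<open>
  \<open>exec c s t out s'\<close>: started in store \<open>s\<close>, program \<open>c\<close> halts in store \<open>s'\<close> after total cost
  \<open>t\<close>, having written the numbers \<open>out\<close> in this order.
\<close>

inductive exec :: "com \<Rightarrow> store \<Rightarrow> nat \<Rightarrow> nat list \<Rightarrow> store \<Rightarrow> bool" where
  Skip: "exec Skip s 1 [] s"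
| Assign: "exec (Assign x i a) s
    (acost i s + acost a s + bits (aval i s) + bits (aval a s)) []
    (upd s x (aval i s) (aval a s))"
| Write: "exec (Write a) s (acost a s + bits (aval a s)) [aval a s] s"
| Seq: "exec c1 s t1 out1 s1 \<Longrightarrow> exec c2 s1 t2 out2 s2 \<Longrightarrow>
    exec (Seq c1 c2) s (t1 + t2) (out1 @ out2) s2"
| CondTrue: "aval b s \<noteq> 0 \<Longrightarrow> exec c1 s t out s' \<Longrightarrow>
    exec (Cond b c1 c2) s (acost b s + t) out s'"
| CondFalse: "aval b s = 0 \<Longrightarrow> exec c2 s t out s' \<Longrightarrow>
    exec (Cond b c1 c2) s (acost b s + t) out s'"
| WhileFalse: "aval b s = 0 \<Longrightarrow> exec (While b c) s (acost b s) [] s"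
| WhileTrue: "aval b s \<noteq> 0 \<Longrightarrow> exec c s t1 out1 s1 \<Longrightarrow> exec (While b c) s1 t2 out2 s2 \<Longrightarrow>
    exec (While b c) s (acost b s + t1 + t2) (out1 @ out2) s2"

inductive_cases SkipE: "exec Skip s t out s'"
inductive_cases AssignE: "exec (Assign x i a) s t out s'"
inductive_cases WriteE: "exec (Write a) s t out s'"
inductive_cases SeqE: "exec (Seq c1 c2) s t out s'"
inductive_cases CondE: "exec (Cond b c1 c2) s t out s'"
inductive_cases WhileE: "exec (While b c) s t out s'"

lemma exec_deterministic:
  "exec c s t out s' \<Longrightarrow> exec c s u out' s'' \<Longrightarrow> t = u \<and> out = out' \<and> s' = s''"
proof (induction arbitrary: u out' s'' rule: exec.induct)
  case (Seq c1 s t1 out1 s1 c2 t2 out2 s2)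
  from Seq.prems obtain u1 o1 r1 u2 o2 where
    "exec c1 s u1 o1 r1" "exec c2 r1 u2 o2 s''" "u = u1 + u2" "out' = o1 @ o2"
    by (rule SeqE)
  with Seq.IH(1)[of u1 o1 r1] Seq.IH(2)[of u2 o2 s''] show ?case by simp
next
  case (WhileTrue b s c t1 out1 s1 t2 out2 s2)
  from WhileTrue.prems WhileTrue.hyps(1) obtain u1 o1 r1 u2 o2 where
    "exec c s u1 o1 r1" "exec (While b c) r1 u2 o2 s''"
    "u = acost b s + u1 + u2" "out' = o1 @ o2"
    by - (erule WhileE; simp)
  with WhileTrue.IH(1)[of u1 o1 r1] WhileTrue.IH(2)[of u2 o2 s''] show ?case by simp
next
  case (CondTrue b s c1 t out s' c2)
  from CondTrue.prems CondTrue.hyps(1) obtain u1 where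
    "exec c1 s u1 out' s''" "u = acost b s + u1"
    by (elim CondE) simp_all
  with CondTrue.IH[of u1 out' s''] show ?case by simp
next
  case (CondFalse b s c2 t out s' c1)
  from CondFalse.prems CondFalse.hyps(1) obtain u1 where
    "exec c2 s u1 out' s''" "u = acost b s + u1"
    by (elim CondE) simp_all
  with CondFalse.IH[of u1 out' s''] show ?case by simp
next
  case (WhileFalse b s c)
  from WhileFalse.prems WhileFalse.hyps show ?case
    by - (erule WhileE; simp)
next
  case (Skip s)
  then show ?case by (elim SkipE) simp
next
  case (Assign x i a s)
  then show ?case by (elim AssignE) simp
next
  case (Write a s)
  then show ?case by (elim WriteE) simp
qed

lemma exec_output_le: "exec c s t out s' \<Longrightarrow> sum_list (map bits out) \<le> t"
  by (induction rule: exec.induct) auto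

section \<open>Polynomial-time many-one reductions\<close>

definition init_store :: "nat list \<Rightarrow> store" where
  "init_store xs = (\<lambda>x i. if x = ''input''
     then (if i = 0 then length xs else if i \<le> length xs then xs ! (i - 1) else 0) else 0)"

definition input_size :: "nat list \<Rightarrow> nat" where
  "input_size xs = sum_list (map bits xs)"

record 'a decision_problem =
  instances :: "'a set"
  encode :: "'a \<Rightarrow> nat list"
  yes_instance :: "'a \<Rightarrow> bool"

definition poly_time_computable ::
  "'a decision_problem \<Rightarrow> 'b decision_problem \<Rightarrow> ('a \<Rightarrow> 'b) \<Rightarrow> bool" where
  "poly_time_computable A B f \<longleftrightarrow>
     (\<exists>(c :: com) (p :: nat poly). \<forall>x \<in> instances A. \<exists>t s'.
        exec c (init_store (encode A x)) t (encode B (f x)) s' \<and>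
        t \<le> poly p (input_size (encode A x)))"

definition poly_time_reducible :: "'a decision_problem \<Rightarrow> 'b decision_problem \<Rightarrow> bool" where
  "poly_time_reducible A B \<longleftrightarrow>
     (\<exists>f. poly_time_computable A B f \<and>
        (\<forall>x \<in> instances A. f x \<in> instances B \<and> (yes_instance A x \<longleftrightarrow> yes_instance B (f x))))"

section \<open>The Windows Scheduling Problem\<close>

definition job_slots :: "int \<Rightarrow> nat \<Rightarrow> int set" where
  "job_slots t p = {t + k * int p | k. True}"

definition feasible_schedule :: "nat list \<Rightarrow> (nat \<Rightarrow> int) \<Rightarrow> bool" where
  "feasible_schedule ps t \<longleftrightarrow>
     (\<forall>j < length ps. \<forall>k < length ps. j \<noteq> k \<longrightarrow>
        job_slots (t j) (ps ! j) \<inter> job_slots (t k) (ps ! k) = {})"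

definition windows_scheduling :: "nat list decision_problem" where
  "windows_scheduling =
     \<lparr>instances = {ps. \<forall>p \<in> set ps. p > 0},
      encode = (\<lambda>ps. ps),
      yes_instance = (\<lambda>ps. \<exists>t. feasible_schedule ps t)\<rparr>"

section \<open>The Partial Coding Problem\<close>

text \<open>
  An instance \<open>(fs, ss)\<close> consists of the list of value ranges and the list of symbols;
  attributes, like list positions, are numbered from 0.
\<close>

type_synonym pcp_instance = "nat list \<times> nat set list"

definition pcp_instances :: "pcp_instance set" where
  "pcp_instances = {(fs, ss). (\<forall>r \<in> set fs. r \<ge> 2) \<and> (\<forall>S \<in> set ss. S \<subseteq> {..<length fs})}"

definition is_encoding :: "nat list \<Rightarrow> nat set \<Rightarrow> (nat \<Rightarrow> nat) \<Rightarrow> bool" where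
  "is_encoding fs S c \<longleftrightarrow> (\<forall>i \<in> S. c i \<in> {0..fs ! i - 1})"

definition feasible_encoding :: "pcp_instance \<Rightarrow> (nat \<Rightarrow> nat \<Rightarrow> nat) \<Rightarrow> bool" where
  "feasible_encoding = (\<lambda>(fs, ss) c.
     (\<forall>j < length ss. is_encoding fs (ss ! j) (c j)) \<and>
     (\<forall>j < length ss. \<forall>k < length ss. j \<noteq> k \<longrightarrow>
        (\<exists>i \<in> ss ! j \<inter> ss ! k. c j i \<noteq> c k i)))"

text \<open>Symbols are written as rows of the 0/1 incidence matrix.\<close>

definition pcp_encode :: "pcp_instance \<Rightarrow> nat list" where
  "pcp_encode = (\<lambda>(fs, ss). length fs # fs @ length ss #
     concat (map (\<lambda>S. map (\<lambda>i. if i \<in> S then 1 else 0) [0..<length fs]) ss))"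

definition partial_coding :: "pcp_instance decision_problem" where
  "partial_coding =
     \<lparr>instances = pcp_instances,
      encode = pcp_encode,
      yes_instance = (\<lambda>I. \<exists>c. feasible_encoding I c)\<rparr>"

lemma inj_on_pcp_encode: "inj_on pcp_encode pcp_instances"
proof (rule inj_onI, clarify)
  fix fs gs :: "nat list" and ss us :: "nat set list"
  assume I: "(fs, ss) \<in> pcp_instances" "(gs, us) \<in> pcp_instances"
    and eq: "pcp_encode (fs, ss) = pcp_encode (gs, us)"
  define row where "row = (\<lambda>S. map (\<lambda>i. if i \<in> S then 1 else 0 :: nat) [0..<length fs])"
  have fs: "fs = gs" and len: "length ss = length us"
    and rows: "concat (map row ss) = concat (map row us)"
    using eq by (auto simp: pcp_encode_def row_def)
  have "length x = length y" if "(x, y) \<in> set (zip (map row ss) (map row us))" for x y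
    using set_zip_leftD[OF that] set_zip_rightD[OF that] by (auto simp: row_def)
  then have "map row ss = map row us"
    using rows len by (intro concat_injective) auto
  moreover have "inj_on row {S. S \<subseteq> {..<length fs}}"
  proof (rule inj_on_inverseI)
    fix S assume "S \<in> {S. S \<subseteq> {..<length fs}}"
    then show "(\<lambda>r. {i. i < length fs \<and> r ! i = 1}) (row S) = S"
      by (auto simp: row_def split: if_splits)
  qed
  moreover have "set ss \<union> set us \<subseteq> {S. S \<subseteq> {..<length fs}}"
    using I fs by (auto simp: pcp_instances_def)
  ultimately have "ss = us"
    by (meson inj_on_subset map_inj_on)
  with fs show "fs = gs \<and> ss = us" by simp
qed

end

(*
  A schedule is feasible iff t_j and t_k are incongruent modulo gcd(p_j, p_k) for all j, k. Factoring
  the periods is avoided by a coprime base: pairwise coprime q_i such that every period is a product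
  of powers of them. Then gcd(p_j, p_k) divides z iff every common divisor q_i^l of the two periods
  divides z, so t_j and t_k collide iff, for all i, their base-q_i expansions agree in the digits
  below min(e_ij, e_ik), where e_ij is the exponent of q_i in p_j. With one attribute of range q_i
  per digit position l, contained in the symbols j with q_i^(l+1) | p_j, this is exactly a collision
  of codes; conversely the Chinese remainder theorem turns digits into start times. A coprime base is
  found by splitting pairs b_i, b_j with gcd g > 1 into b_i/g, b_j/g, g: each split at least halves
  the product of the base, so there are at most log2 (p_1 ... p_n) of them.
*)
theory Submission
  imports Defs "HOL-Number_Theory.Cong"
begin

section \<open>Coprime bases\<close>

text \<open>The exponents e_ij are never computed. Membership of an attribute in a symbol is a
  divisibility test, and the gcd criterion ranges over all common divisors q_i^l, so exponents only
  have to exist. This matters because splitting may leave base elements equal to 1, whose exponents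
  are not determined. Polynomial size rests on two bounds in terms of the input size S. The base has
  at most 2S elements: the periods and one more per split. The bit length L of the product of all
  periods is at most S + 1 and exceeds every exponent of a base element q_i \<ge> 2, since 2^e \<le>
  q_i^e \<le> p < 2^L. Hence one uniform grid of m * L attributes suffices, with coordinates found
  by division. All intermediate numbers are at most a single power of 2 whose exponent is quadratic
  in S. The logarithmic cost of one operation is therefore polynomial, and only operations have to
  be counted. The Euclidean algorithm and the refinement loop need a decreasing measure for this;
  all other loops have a round count known in advance.\<close>

text \<open>A common slot solves t + k p = u + l r, and by Bezout the integer combinations of p and
  r are exactly the multiples of their gcd.\<close>

lemma disjoint_job_slots_iff:
  "job_slots t p \<inter> job_slots u r = {} \<longleftrightarrow> \<not> int (gcd p r) dvd t - u"
proof -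
  have "job_slots t p \<inter> job_slots u r \<noteq> {} \<longleftrightarrow> (\<exists>k l. t + k * int p = u + l * int r)"
    by (auto simp: job_slots_def)
  also have "\<dots> \<longleftrightarrow> int (gcd p r) dvd t - u"
  proof
    assume "\<exists>k l. t + k * int p = u + l * int r"
    then obtain k l where "t - u = l * int r - k * int p"
      by (auto simp: algebra_simps)
    moreover have "int (gcd p r) dvd l * int r - k * int p"
      by (intro dvd_diff dvd_mult) auto
    ultimately show "int (gcd p r) dvd t - u" by simp
  next
    assume "int (gcd p r) dvd t - u"
    then obtain z where z: "t - u = int (gcd p r) * z" ..
    obtain x y where "x * int p + y * int r = gcd (int p) (int r)"
      using bezout_int by blast
    then have "t - u = (x * int p + y * int r) * z"
      using z by simp
    then have "t + (- x * z) * int p = u + (y * z) * int r"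
      by (simp add: algebra_simps)
    then show "\<exists>k l. t + k * int p = u + l * int r" by blast
  qed
  finally show ?thesis by blast
qed

section \<open>Digits in base q\<close>

text \<open>The residue modulo q^(e+1) consists of the digit at position e and the residue modulo
  q^e. The integers are used because start times may be negative; floored division gives them digits
  as well.\<close>

lemma mod_power_eq_iff_digits_eq:
  fixes x y q :: int
  assumes "q > 0"
  shows "x mod q ^ e = y mod q ^ e \<longleftrightarrow> (\<forall>l<e. x div q ^ l mod q = y div q ^ l mod q)"
proof (induction e)
  case (Suc e)
  have split: "z mod q ^ Suc e = q ^ e * (z div q ^ e mod q) + z mod q ^ e" for z
    using zmod_zmult2_eq[of q z "q ^ e"] assms by (simp add: mult.commute)
  have "z mod q ^ Suc e mod q ^ e = z mod q ^ e" for z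
    by (simp add: mod_mod_cancel)
  then have "x mod q ^ Suc e = y mod q ^ Suc e \<Longrightarrow> x mod q ^ e = y mod q ^ e"
    by metis
  then have "x mod q ^ Suc e = y mod q ^ Suc e \<longleftrightarrow>
      x mod q ^ e = y mod q ^ e \<and> x div q ^ e mod q = y div q ^ e mod q"
    using assms unfolding split by auto
  then show ?case
    using Suc by (auto simp: less_Suc_eq)
qed simp

text \<open>Horner's scheme: the induction peels off digit 0, so \<open>d\<close> is generalized and
  shifted by one.\<close>

lemma ex_number_with_digits:
  fixes q :: nat
  assumes "\<And>l. d l < q"
  shows "\<exists>x. \<forall>l<e. x div q ^ l mod q = d l"
  using assms
proof (induction e arbitrary: d)
  case (Suc e)
  from Suc.IH[of "\<lambda>l. d (Suc l)"] Suc.prems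
  obtain x where x: "\<forall>l<e. x div q ^ l mod q = d (Suc l)" by blast
  have "(d 0 + q * x) div q ^ l mod q = d l" if "l < Suc e" for l
  proof (cases l)
    case (Suc k)
    have "(d 0 + q * x) div q ^ l = x div q ^ k"
      using Suc.prems[of 0] by (simp add: Suc div_mult2_eq)
    then show ?thesis using x that Suc by simp
  qed (use Suc.prems[of 0] in simp)
  then show ?case by blast
qed simp

section \<open>Common divisors over a coprime base\<close>

text \<open>The gcd need not be evaluated. As a divisor of the first product it factors into g1 and
  g2, dividing the first m powers and the last one; coprimality sends them to the matching factors
  of the second product. So both divide z, and being coprime, their product does too.\<close>

lemma gcd_prod_powers_dvd:
  fixes q :: "nat \<Rightarrow> nat"
  assumes cop: "\<And>i k. i < m \<Longrightarrow> k < m \<Longrightarrow> i \<noteq> k \<Longrightarrow> coprime (q i) (q k)"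
    and dvd: "\<And>i. i < m \<Longrightarrow> q i ^ min (e i) (f i) dvd z"
  shows "gcd (\<Prod>i<m. q i ^ e i) (\<Prod>i<m. q i ^ f i) dvd z"
  using assms
proof (induction m)
  case (Suc m)
  let ?x = "\<Prod>i<m. q i ^ e i" and ?y = "\<Prod>i<m. q i ^ f i"
  let ?g = "gcd (?x * q m ^ e m) (?y * q m ^ f m)"
  have cop: "coprime (\<Prod>i<m. q i ^ h i) (q m ^ k)" for h k
    by (intro prod_coprime_left coprime_power_left_iff[THEN iffD2] coprime_power_right_iff[THEN iffD2])
       (auto intro: Suc.prems(1))
  obtain g1 g2 where g: "?g = g1 * g2" "g1 dvd ?x" "g2 dvd q m ^ e m"
    using division_decomp[of ?g ?x "q m ^ e m"] by auto
  have "g1 * g2 dvd ?y * q m ^ f m"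
    using g(1) by (metis gcd_dvd2)
  then have *: "g1 dvd ?y * q m ^ f m" "g2 dvd ?y * q m ^ f m"
    by (auto dest: dvd_mult_left dvd_mult_right)
  have "coprime g1 (q m ^ f m)"
    using coprime_divisors[OF g(2) dvd_refl cop] .
  with *(1) have "g1 dvd ?y" by (simp add: coprime_dvd_mult_left_iff)
  moreover have "coprime g2 ?y"
    using coprime_divisors[OF g(3) dvd_refl cop[THEN coprime_commute[THEN iffD1]]] .
  with *(2) have "g2 dvd q m ^ f m" by (simp add: coprime_dvd_mult_right_iff)
  ultimately have "g1 dvd gcd ?x ?y" "g2 dvd q m ^ min (e m) (f m)"
    using g by (auto simp: min_def)
  moreover have "gcd ?x ?y dvd z"
    using Suc.prems by (intro Suc.IH) auto
  moreover have "q m ^ min (e m) (f m) dvd z"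
    using Suc.prems(2) by blast
  ultimately have "g1 dvd z" "g2 dvd z" by (auto intro: dvd_trans)
  moreover have "coprime g1 g2"
    using coprime_divisors[OF g(2,3) cop] .
  ultimately have "g1 * g2 dvd z" by (simp add: divides_mult)
  then show ?case using g(1) by simp
qed simp

text \<open>The exponents occur only in the hypotheses. The right-hand side speaks of divisibility
  by powers, which can be tested without knowing exponents and which is the shape of the symbols in
  the coding instance.\<close>

lemma coprime_base_gcd_dvd_iff:
  fixes q :: "nat \<Rightarrow> nat" and z :: int
  assumes cop: "\<And>i k. i < m \<Longrightarrow> k < m \<Longrightarrow> i \<noteq> k \<Longrightarrow> coprime (q i) (q k)"
    and "p = (\<Prod>i<m. q i ^ e i)" "r = (\<Prod>i<m. q i ^ f i)"
  shows "int (gcd p r) dvd z \<longleftrightarrow>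
    (\<forall>i<m. \<forall>l. q i ^ l dvd p \<longrightarrow> q i ^ l dvd r \<longrightarrow> int (q i ^ l) dvd z)"
proof (intro iffI allI impI)
  fix i l
  assume "int (gcd p r) dvd z" "q i ^ l dvd p" "q i ^ l dvd r"
  then show "int (q i ^ l) dvd z"
    by (meson dvd_trans gcd_greatest int_dvd_int_iff)
next
  assume *: "\<forall>i<m. \<forall>l. q i ^ l dvd p \<longrightarrow> q i ^ l dvd r \<longrightarrow> int (q i ^ l) dvd z"
  have "gcd p r dvd nat \<bar>z\<bar>"
    unfolding assms(2,3)
  proof (rule gcd_prod_powers_dvd[OF cop])
    fix i assume i: "i < m"
    have "q i ^ min (e i) (f i) dvd (\<Prod>i<m. q i ^ h i)" if "min (e i) (f i) \<le> h i" for h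
      using dvd_prodI[of "{..<m}" i "\<lambda>i. q i ^ h i"] i le_imp_power_dvd[OF that, of "q i"]
      by (auto intro: dvd_trans)
    then have "int (q i ^ min (e i) (f i)) dvd z"
      using * i assms(2,3) by auto
    then show "q i ^ min (e i) (f i) dvd nat \<bar>z\<bar>"
      by (simp add: nat_abs_dvd_iff int_dvd_int_iff[symmetric])
  qed auto
  then show "int (gcd p r) dvd z"
    by (metis dvd_abs_iff int_dvd_int_iff int_nat_eq abs_ge_zero)
qed

section \<open>Refining the periods into a coprime base\<close>

lemma prod_lessThan_split_two:
  fixes f :: "nat \<Rightarrow> 'a :: comm_monoid_mult"
  assumes "i < m" "j < m" "i \<noteq> j"
  shows "(\<Prod>k<m. f k) = f i * f j * (\<Prod>k\<in>{..<m} - {i, j}. f k)"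
  using assms prod.remove[of "{..<m}" i f] prod.remove[of "{..<m} - {i}" j f]
  by (simp add: mult.assoc Diff_insert2[symmetric])

text \<open>
  A split replaces \<open>b i\<close> and \<open>b j\<close> by \<open>b i div g\<close>, \<open>b j div g\<close> and \<open>g\<close>, where \<open>g\<close> is their gcd.
  This divides the product by \<open>g \<ge> 2\<close>, so the power of 2 in front of the product bounds the
  number of splits.
\<close>

definition refinement :: "nat list \<Rightarrow> nat \<Rightarrow> (nat \<Rightarrow> nat) \<Rightarrow> nat \<Rightarrow> nat \<Rightarrow> bool" where
  "refinement ps m b i j \<longleftrightarrow>
     length ps \<le> m \<and> i \<le> m \<and> i < j \<and> j \<le> Suc m \<and> (\<forall>k<m. 0 < b k) \<and>
     2 ^ (m - length ps) * (\<Prod>k<m. b k) \<le> prod_list ps \<and>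
     (\<forall>h<i. \<forall>k<m. h \<noteq> k \<longrightarrow> coprime (b h) (b k)) \<and>
     (\<forall>k<m. i < k \<longrightarrow> k < j \<longrightarrow> coprime (b i) (b k)) \<and>
     (\<forall>p\<in>set ps. \<exists>e. p = (\<Prod>k<m. b k ^ e k))"

lemma refinement_init:
  assumes pos: "\<And>p. p \<in> set ps \<Longrightarrow> 0 < p" and b: "\<And>k. k < length ps \<Longrightarrow> b k = ps ! k"
  shows "refinement ps (length ps) b 0 1"
proof -
  have "\<exists>e. p = (\<Prod>k<length ps. b k ^ e k)" if p: "p \<in> set ps" for p
  proof -
    obtain h where h: "h < length ps" "p = ps ! h"
      using p by (metis in_set_conv_nth)
    have "(\<Prod>k<length ps. b k ^ (if k = h then 1 else 0)) = (\<Prod>k<length ps. if k = h then b h else 1)"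
      by (rule prod.cong) auto
    also have "\<dots> = p" using h b by simp
    finally show ?thesis by metis
  qed
  moreover have "(\<Prod>k<length ps. b k) = prod_list ps"
    using b by (simp add: prod.list_conv_set_nth atLeast0LessThan)
  ultimately show ?thesis
    using pos b by (auto simp: refinement_def)
qed

lemma refinement_next_j:
  assumes "refinement ps m b i j" "j < m" "coprime (b i) (b j)"
  shows "refinement ps m b i (Suc j)"
  using assms by (auto simp: refinement_def less_Suc_eq)

text \<open>Once j has passed the end, all pairs of i are settled: partners above i by the scan,
  partners below i by symmetry from their own scans. The scan restarts right after the new index, at
  i + 2; for i + 1 = m this is m + 1, hence the bound \<open>j \<le> Suc m\<close> in the
  invariant.\<close>

lemma refinement_next_i:
  assumes "refinement ps m b i j" "i < m" "m \<le> j"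
  shows "refinement ps m b (Suc i) (Suc (Suc i))"
proof -
  have "coprime (b h) (b k)" if "h < Suc i" "k < m" "h \<noteq> k" for h k
  proof (cases "h = i")
    case True
    have "k < i \<or> i < k \<and> k < j" using that True assms(3) by auto
    then show ?thesis
      using assms that True unfolding refinement_def by (metis coprime_commute)
  next
    case False
    then show ?thesis using assms that by (auto simp: refinement_def)
  qed
  with assms show ?thesis by (auto simp: refinement_def)
qed

text \<open>The indices i and j stay, since b i / g and b j / g may still share a factor.
  Coprimality already established survives because every new element divides an old one; g is placed
  at m, beyond j, so its pair with i comes up later. In each period g receives the exponent
  \<open>e i + e j\<close>.\<close>

lemma refinement_split:
  assumes r: "refinement ps m b i j" and ij: "j < m" and g: "g = gcd (b i) (b j)" "1 < g"
  shows "refinement ps (Suc m) (b(i := b i div g, j := b j div g, m := g)) i j"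
proof -
  let ?b = "b(i := b i div g, j := b j div g, m := g)"
  let ?R = "\<lambda>f. \<Prod>k\<in>{..<m} - {i, j}. f k"
  have less: "i < m" "i \<noteq> j" "i < j" using r ij by (auto simp: refinement_def)
  obtain x y where xy: "b i = g * x" "b j = g * y"
    using g(1) by (metis gcd_dvd1 gcd_dvd2 dvdE)
  have b': "?b i = x" "?b j = y" "?b m = g" "\<And>k. k \<notin> {i, j, m} \<Longrightarrow> ?b k = b k"
    using xy g(2) less ij by auto
  have dvd: "?b k dvd b k" if "k < m" for k
    using that xy b'(1,2) b'(4)[of k] by (cases "k = i \<or> k = j") (auto simp del: fun_upd_apply)
  have pos: "0 < b k" if "k < m" for k using r that by (simp add: refinement_def)
  have prod: "(\<Prod>k<Suc m. f k) = f m * (f i * f j * ?R f)" for f :: "nat \<Rightarrow> nat"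
    using less ij by (simp add: prod_lessThan_split_two[of i m j] mult.commute)
  have rest1: "?R ?b = ?R b"
    by (rule prod.cong) auto
  have rest: "?R (\<lambda>k. ?b k ^ e k) = ?R (\<lambda>k. b k ^ e k)" for e
    by (rule prod.cong) auto
  have "0 < ?b k" if "k < Suc m" for k
    using that pos[of k] dvd[of k] b'(3) g(2) by (metis dvd_pos_nat less_Suc_eq not_one_less_zero not_gr_zero)
  moreover have "2 ^ (Suc m - length ps) * (\<Prod>k<Suc m. ?b k) \<le> prod_list ps"
  proof -
    have "2 ^ (Suc m - length ps) * (\<Prod>k<Suc m. ?b k) =
        2 * (2 ^ (m - length ps) * (g * (x * y * ?R b)))"
      using r unfolding prod rest1 b'(1-3) by (simp add: Suc_diff_le refinement_def)
    also have "\<dots> \<le> g * (2 ^ (m - length ps) * (g * (x * y * ?R b)))"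
      using g(2) by (intro mult_right_mono) auto
    also have "\<dots> = 2 ^ (m - length ps) * (\<Prod>k<m. b k)"
      using less ij xy by (simp add: prod_lessThan_split_two[of i m j] ac_simps)
    also have "\<dots> \<le> prod_list ps" using r by (simp add: refinement_def)
    finally show ?thesis .
  qed
  moreover have "coprime (?b h) (?b k)" if "h < i" "k < Suc m" "h \<noteq> k" for h k
  proof -
    \<comment> \<open>The new element at index m divides the old \<open>b j\<close> and inherits its
      coprimality to \<open>b h\<close>.\<close>
    define k' where "k' = (if k = m then j else k)"
    have "k' < m" "h \<noteq> k'" "?b k dvd b k'"
      using that less ij dvd[of k] b'(3) xy by (auto simp: k'_def simp del: fun_upd_apply)
    moreover from this have "coprime (b h) (b k')"
      using r that by (auto simp: refinement_def)
    moreover have "?b h dvd b h" using dvd that less by auto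
    ultimately show ?thesis by (metis coprime_divisors)
  qed
  moreover have "coprime (?b i) (?b k)" if "i < k" "k < j" for k
  proof -
    have "coprime (b i) (b k)" using r that ij by (auto simp: refinement_def)
    moreover have "?b i dvd b i" "?b k dvd b k" using dvd[of i] dvd[of k] that less ij by linarith+
    ultimately show ?thesis by (metis coprime_divisors)
  qed
  moreover have "\<exists>e. p = (\<Prod>k<Suc m. ?b k ^ e k)" if p: "p \<in> set ps" for p
  proof -
    obtain e where e: "p = (\<Prod>k<m. b k ^ e k)" using r p by (auto simp: refinement_def)
    have "p = b i ^ e i * b j ^ e j * ?R (\<lambda>k. b k ^ e k)"
      using e less ij by (simp add: prod_lessThan_split_two[of i m j])
    also have "\<dots> = g ^ (e i + e j) * (x ^ e i * y ^ e j * ?R (\<lambda>k. ?b k ^ e k))"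
      unfolding rest by (simp add: xy power_mult_distrib power_add)
    also have "?R (\<lambda>k. ?b k ^ e k) = ?R (\<lambda>k. ?b k ^ (e(m := e i + e j)) k)"
      by (rule prod.cong) auto
    also have "g ^ (e i + e j) * (x ^ e i * y ^ e j * \<dots>) = (\<Prod>k<Suc m. ?b k ^ (e(m := e i + e j)) k)"
      using less ij unfolding prod b'(1-3) by simp
    finally show ?thesis by blast
  qed
  ultimately show ?thesis
    using r less ij by (auto simp: refinement_def simp del: fun_upd_apply)
qed

text \<open>Both factors in the product bound of the invariant are at least 1, so each alone is at
  most the product of the periods. The first bound keeps the numbers small, the second limits the
  number of splits.\<close>

lemma refinement_bounds:
  assumes "refinement ps m b i j"
  shows "k < m \<Longrightarrow> b k \<le> prod_list ps" "2 ^ (m - length ps) \<le> prod_list ps"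
proof -
  have pos: "0 < b k" if "k < m" for k using assms that by (simp add: refinement_def)
  then have prod_pos: "0 < (\<Prod>k<m. b k)" by (auto intro: prod_pos)
  have le: "2 ^ (m - length ps) * (\<Prod>k<m. b k) \<le> prod_list ps"
    using assms by (simp add: refinement_def)
  then show "2 ^ (m - length ps) \<le> prod_list ps"
    using prod_pos by (metis le_trans mult.right_neutral mult_le_mono2 Suc_leI One_nat_def)
  assume "k < m"
  then have "b k \<le> (\<Prod>k<m. b k)"
    using prod_pos by (intro dvd_imp_le dvd_prodI) auto
  also have "\<dots> \<le> 2 ^ (m - length ps) * (\<Prod>k<m. b k)" by simp
  finally show "b k \<le> prod_list ps" using le by simp
qed

section \<open>The coding instance of a coprime base\<close>

text \<open>
  Attribute \<open>i * L + l\<close> stands for digit \<open>l\<close> of a start time in base \<open>q i\<close>. Trivial base elements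
  \<open>q i = 1\<close> occur in no symbol; their attributes only pad the grid and need a range of at least 2.
\<close>

definition base_pcp :: "nat \<Rightarrow> nat \<Rightarrow> (nat \<Rightarrow> nat) \<Rightarrow> nat list \<Rightarrow> pcp_instance" where
  "base_pcp m L q ps =
     (map (\<lambda>a. max (q (a div L)) 2) [0..<m * L],
      map (\<lambda>p. {a. a < m * L \<and> 2 \<le> q (a div L) \<and> q (a div L) ^ Suc (a mod L) dvd p}) ps)"

lemma base_pcp_in_instances: "base_pcp m L q ps \<in> pcp_instances"
  by (auto simp: base_pcp_def pcp_instances_def)

text \<open>The assumption on \<open>L\<close> guarantees that the grid holds every digit that can
  separate two jobs: a power q^e dividing a period, with q \<ge> 2, has e < L.\<close>

lemma feasible_schedule_iff_base_pcp:
  assumes cop: "\<And>i k. i < m \<Longrightarrow> k < m \<Longrightarrow> i \<noteq> k \<Longrightarrow> coprime (q i) (q k)"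
    and pos: "\<And>i. i < m \<Longrightarrow> 0 < q i"
    and base: "\<And>p. p \<in> set ps \<Longrightarrow> \<exists>e. p = (\<Prod>i<m. q i ^ e i)"
    and L: "\<And>p. p \<in> set ps \<Longrightarrow> p < 2 ^ L"
  shows "(\<exists>t. feasible_schedule ps t) \<longleftrightarrow> (\<exists>c. feasible_encoding (base_pcp m L q ps) c)"
proof -
  let ?ss = "\<lambda>j. {a. a < m * L \<and> 2 \<le> q (a div L) \<and> q (a div L) ^ Suc (a mod L) dvd ps ! j}"
  have ps_pos: "0 < p" if "p \<in> set ps" for p
    using base[OF that] pos by (auto intro!: prod_pos)
  have gcd_dvd: "int (gcd (ps ! j) (ps ! k)) dvd z \<longleftrightarrow>
      (\<forall>i<m. \<forall>l. q i ^ l dvd ps ! j \<longrightarrow> q i ^ l dvd ps ! k \<longrightarrow> int (q i ^ l) dvd z)"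
    if jk: "j < length ps" "k < length ps" for j k z
  proof -
    obtain e f where "ps ! j = (\<Prod>i<m. q i ^ e i)" "ps ! k = (\<Prod>i<m. q i ^ f i)"
      using base jk by (meson nth_mem)
    from coprime_base_gcd_dvd_iff[OF cop this] show ?thesis by blast
  qed
  have sched: "feasible_schedule ps t \<longleftrightarrow>
      (\<forall>j<length ps. \<forall>k<length ps. j \<noteq> k \<longrightarrow> (\<exists>i<m. \<exists>l. q i ^ l dvd ps ! j \<and> q i ^ l dvd ps ! k \<and>
        \<not> int (q i ^ l) dvd t j - t k))" for t
    by (auto simp: feasible_schedule_def disjoint_job_slots_iff gcd_dvd)
  have enc: "feasible_encoding (base_pcp m L q ps) c \<longleftrightarrow>
      (\<forall>j<length ps. \<forall>a\<in>?ss j. c j a < q (a div L)) \<and>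
      (\<forall>j<length ps. \<forall>k<length ps. j \<noteq> k \<longrightarrow> (\<exists>a\<in>?ss j \<inter> ?ss k. c j a \<noteq> c k a))" for c
  proof -
    \<comment> \<open>Attributes in a symbol have a base element of at least 2, so the padded range
      \<open>max q 2\<close> is q itself there.\<close>
    have "is_encoding (map (\<lambda>a. max (q (a div L)) 2) [0..<m * L]) (?ss j) (c j) \<longleftrightarrow>
        (\<forall>a\<in>?ss j. c j a < q (a div L))" for j
      unfolding is_encoding_def by (rule ball_cong) auto
    then show ?thesis
      by (simp add: feasible_encoding_def base_pcp_def)
  qed
  show ?thesis
  proof
    assume "\<exists>t. feasible_schedule ps t"
    then obtain t where t: "feasible_schedule ps t" ..
    \<comment> \<open>Digits are taken in the integers, where the remainder is nonnegative even for
      a negative start time; \<open>nat\<close> therefore loses nothing.\<close>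
    define c where "c j a = nat (t j div int (q (a div L)) ^ (a mod L) mod int (q (a div L)))" for j a
    have "c j a < q (a div L)" if "a \<in> ?ss j" for j a
      using that by (auto simp: c_def nat_less_iff)
    moreover have "\<exists>a\<in>?ss j \<inter> ?ss k. c j a \<noteq> c k a"
      if jk: "j < length ps" "k < length ps" "j \<noteq> k" for j k
    proof -
      obtain i e where i: "i < m" "q i ^ e dvd ps ! j" "q i ^ e dvd ps ! k"
          "\<not> int (q i ^ e) dvd t j - t k"
        using t jk unfolding sched by blast
      \<comment> \<open>Powers of 1 divide every difference, so a separating base element is not
        trivial.\<close>
      have q: "2 \<le> q i"
        using pos[OF i(1)] i(4) by (cases "q i = 1") auto
      have "t j mod int (q i) ^ e \<noteq> t k mod int (q i) ^ e"
        using i(4) by (simp add: mod_eq_dvd_iff)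
      then obtain l where l: "l < e"
          "t j div int (q i) ^ l mod int (q i) \<noteq> t k div int (q i) ^ l mod int (q i)"
        using mod_power_eq_iff_digits_eq[of "int (q i)"] q by auto
      have "2 ^ e \<le> q i ^ e" using q by (simp add: power_mono)
      also have "\<dots> \<le> ps ! j" using i(2) jk ps_pos by (simp add: dvd_imp_le)
      also have "\<dots> < 2 ^ L" using L jk by simp
      finally have "l < L" using l by simp
      define a where "a = i * L + l"
      have a: "a div L = i" "a mod L = l" "a < m * L"
        using \<open>l < L\<close> i(1) mult_le_mono1[of "Suc i" m L] by (auto simp: a_def)
      have "q i ^ Suc l dvd q i ^ e" using l by (intro le_imp_power_dvd) simp
      then have "a \<in> ?ss j \<inter> ?ss k"
        using a q i by (auto intro: dvd_trans)
      moreover have "c j a \<noteq> c k a"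
        using l(2) q by (simp add: c_def a nat_eq_iff)
      ultimately show ?thesis by blast
    qed
    ultimately show "\<exists>c. feasible_encoding (base_pcp m L q ps) c"
      unfolding enc by blast
  next
    assume "\<exists>c. feasible_encoding (base_pcp m L q ps) c"
    then obtain c where c: "\<And>j a. j < length ps \<Longrightarrow> a \<in> ?ss j \<Longrightarrow> c j a < q (a div L)"
      and diff: "\<And>j k. j < length ps \<Longrightarrow> k < length ps \<Longrightarrow> j \<noteq> k \<Longrightarrow> \<exists>a\<in>?ss j \<inter> ?ss k. c j a \<noteq> c k a"
      unfolding enc by blast
    have "\<exists>x. \<forall>i<m. \<forall>l<L. i * L + l \<in> ?ss j \<longrightarrow> x div q i ^ l mod q i = c j (i * L + l)"
      if j: "j < length ps" for j
    proof -
      \<comment> \<open>Digits that no attribute of symbol j prescribes are set to 0, a legal digit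
        since every \<open>q i\<close> is positive.\<close>
      define d where "d i l = (if l < L \<and> i * L + l \<in> ?ss j then c j (i * L + l) else 0)" for i l
      have "\<exists>u. \<forall>l<L. u div q i ^ l mod q i = d i l" if "i < m" for i
      proof (rule ex_number_with_digits)
        fix l
        have "(i * L + l) div L = i" if "l < L"
          using that by simp
        then show "d i l < q i"
          using c[OF j, of "i * L + l"] pos[OF \<open>i < m\<close>] by (auto simp: d_def)
      qed
      then obtain u where u: "\<And>i l. i < m \<Longrightarrow> l < L \<Longrightarrow> u i div q i ^ l mod q i = d i l"
        by metis
      \<comment> \<open>The modulus q_i^L fixes all L digits of base q_i at once.\<close>
      have "\<forall>i\<in>{..<m}. \<forall>k\<in>{..<m}. i \<noteq> k \<longrightarrow> coprime (q i ^ L) (q k ^ L)"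
        using cop by simp
      from chinese_remainder_nat[OF _ this]
      obtain x where x: "\<And>i. i < m \<Longrightarrow> [x = u i] (mod q i ^ L)"
        by blast
      have "x div q i ^ l mod q i = u i div q i ^ l mod q i" if "i < m" "l < L" for i l
      proof -
        have "int x mod int (q i) ^ L = int (u i) mod int (q i) ^ L"
          using x[OF that(1)] by (metis cong_def of_nat_power zmod_int)
        then have "int x div int (q i) ^ l mod int (q i) = int (u i) div int (q i) ^ l mod int (q i)"
          using mod_power_eq_iff_digits_eq[of "int (q i)"] pos that by simp
        then show ?thesis
          by (metis of_nat_eq_iff of_nat_power zdiv_int zmod_int)
      qed
      then have "x div q i ^ l mod q i = c j (i * L + l)"
        if "i < m" "l < L" "i * L + l \<in> ?ss j" for i l
        using u[OF that(1,2)] that by (simp add: d_def)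
      then show ?thesis by blast
    qed
    then have "\<exists>t. \<forall>j. j < length ps \<longrightarrow> (\<forall>i<m. \<forall>l<L. i * L + l \<in> ?ss j \<longrightarrow>
        t j div q i ^ l mod q i = c j (i * L + l))"
      by (intro choice) blast
    then obtain t where t: "\<And>j i l. j < length ps \<Longrightarrow> i < m \<Longrightarrow> l < L \<Longrightarrow> i * L + l \<in> ?ss j \<Longrightarrow>
        t j div q i ^ l mod q i = c j (i * L + l)"
      by blast
    have "feasible_schedule ps (\<lambda>j. int (t j))"
      unfolding sched
    proof (intro allI impI)
      fix j k assume jk: "j < length ps" "k < length ps" "j \<noteq> k"
      obtain a where a: "a \<in> ?ss j" "a \<in> ?ss k" "c j a \<noteq> c k a"
        using diff[OF jk] by blast
      define i l where "i = a div L" and "l = a mod L"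
      have "L > 0" using a by (cases L) auto
      then have il: "i < m" "l < L" "i * L + l = a"
        using a(1) by (auto simp: i_def l_def less_mult_imp_div_less)
      have "t j div q i ^ l mod q i \<noteq> t k div q i ^ l mod q i"
        using t[OF jk(1) il(1,2)] t[OF jk(2) il(1,2)] a il(3) by simp
      then have "int (t j) div int (q i) ^ l mod int (q i) \<noteq> int (t k) div int (q i) ^ l mod int (q i)"
        by (metis of_nat_eq_iff of_nat_power zdiv_int zmod_int)
      \<comment> \<open>Differing digits at position l are visible modulo q_i^(l+1). This is why an
        attribute at position l is reserved to the periods divisible by that power.\<close>
      then have "int (t j) mod int (q i) ^ Suc l \<noteq> int (t k) mod int (q i) ^ Suc l"
        using mod_power_eq_iff_digits_eq[of "int (q i)" "int (t j)" "Suc l" "int (t k)"] pos[OF il(1)]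
        by (auto simp del: power_Suc)
      then have "\<not> int (q i ^ Suc l) dvd int (t j) - int (t k)"
        by (simp add: mod_eq_dvd_iff)
      moreover have "q i ^ Suc l dvd ps ! j" "q i ^ Suc l dvd ps ! k"
        using a by (simp_all add: i_def l_def)
      ultimately show "\<exists>i<m. \<exists>l. q i ^ l dvd ps ! j \<and> q i ^ l dvd ps ! k \<and>
          \<not> int (q i ^ l) dvd int (t j) - int (t k)"
        using il(1) by blast
    qed
    then show "\<exists>t. feasible_schedule ps t" by blast
  qed
qed

section \<open>A weakest-precondition calculus for cost\<close>

text \<open>Each compound node is charged for two numbers, its operands or its address and content;
  this is the 2 added per node, in units of \<open>bits M\<close>.\<close>

fun expr_size :: "aexp \<Rightarrow> nat" where
  "expr_size (N n) = 1"
| "expr_size (Cell x i) = expr_size i + 2"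
| "expr_size (Plus a b) = expr_size a + expr_size b + 2"
| "expr_size (Minus a b) = expr_size a + expr_size b + 2"
| "expr_size (Times a b) = expr_size a + expr_size b + 2"
| "expr_size (Div a b) = expr_size a + expr_size b + 2"

text \<open>Only sums, products, constants and cell contents need a bound of their own: truncated
  differences and quotients never exceed their first operand.\<close>

fun bounded_by :: "nat \<Rightarrow> aexp \<Rightarrow> store \<Rightarrow> bool" where
  "bounded_by M (N n) s \<longleftrightarrow> n \<le> M"
| "bounded_by M (Cell x i) s \<longleftrightarrow> bounded_by M i s \<and> s x (aval i s) \<le> M"
| "bounded_by M (Plus a b) s \<longleftrightarrow> bounded_by M a s \<and> bounded_by M b s \<and> aval a s + aval b s \<le> M"
| "bounded_by M (Minus a b) s \<longleftrightarrow> bounded_by M a s \<and> bounded_by M b s"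
| "bounded_by M (Times a b) s \<longleftrightarrow> bounded_by M a s \<and> bounded_by M b s \<and> aval a s * aval b s \<le> M"
| "bounded_by M (Div a b) s \<longleftrightarrow> bounded_by M a s \<and> bounded_by M b s"

lemma bits_mono: "m \<le> n \<Longrightarrow> bits m \<le> bits n"
  by (simp add: bits_def floorlog_mono)

lemma bounded_by_aval: "bounded_by M a s \<Longrightarrow> aval a s \<le> M"
proof (induction a)
  case (Div a b)
  then show ?case by (auto intro: le_trans[OF div_le_dividend])
qed auto

lemmas bounded_by_bits = bits_mono[OF bounded_by_aval]

lemma acost_le: "bounded_by M a s \<Longrightarrow> acost a s \<le> expr_size a * bits M"
proof (induction a)
  case (Cell x i)
  then show ?case
    using bounded_by_bits[of M i s] bits_mono[of "s x (aval i s)" M] by (simp add: algebra_simps)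
next
  case (Plus a b)
  then show ?case
    using bounded_by_bits[of M a s] bounded_by_bits[of M b s] by (simp add: algebra_simps)
next
  case (Minus a b)
  then show ?case
    using bounded_by_bits[of M a s] bounded_by_bits[of M b s] by (simp add: algebra_simps)
next
  case (Times a b)
  then show ?case
    using bounded_by_bits[of M a s] bounded_by_bits[of M b s] by (simp add: algebra_simps)
next
  case (Div a b)
  then show ?case
    using bounded_by_bits[of M a s] bounded_by_bits[of M b s] by (simp add: algebra_simps)
qed (simp add: bits_mono)

text \<open>
  A weakest precondition in which every intermediate value is at most \<open>M\<close>, so that running time
  can be counted in units of \<open>bits M\<close>; the postcondition sees the number \<open>n\<close> of units.
\<close>

definition wp :: "nat \<Rightarrow> com \<Rightarrow> store \<Rightarrow> (nat \<Rightarrow> nat list \<Rightarrow> store \<Rightarrow> bool) \<Rightarrow> bool" where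
  "wp M c s Q \<longleftrightarrow> (\<exists>t n out s'. exec c s t out s' \<and> t \<le> n * bits M \<and> Q n out s')"

lemma wpI: "exec c s t out s' \<Longrightarrow> t \<le> n * bits M \<Longrightarrow> Q n out s' \<Longrightarrow> wp M c s Q"
  unfolding wp_def by blast

lemma wpE:
  assumes "wp M c s Q"
  obtains t n out s' where "exec c s t out s'" "t \<le> n * bits M" "Q n out s'"
  using assms unfolding wp_def by blast

lemma wp_mono:
  "wp M c s P \<Longrightarrow> (\<And>n out s'. P n out s' \<Longrightarrow> Q n out s') \<Longrightarrow> wp M c s Q"
  unfolding wp_def by blast

lemma wp_Assign:
  assumes "bounded_by M i s" "bounded_by M a s"
    "Q (expr_size i + expr_size a + 2) [] (upd s x (aval i s) (aval a s))"
  shows "wp M (Assign x i a) s Q"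
  using acost_le[OF assms(1)] acost_le[OF assms(2)] bounded_by_bits[OF assms(1)]
    bounded_by_bits[OF assms(2)] assms(3)
  by (intro wpI[OF exec.Assign]) (auto simp: algebra_simps)

lemma wp_Write:
  assumes "bounded_by M a s" "Q (expr_size a + 1) [aval a s] s"
  shows "wp M (Write a) s Q"
  using acost_le[OF assms(1)] bounded_by_bits[OF assms(1)] assms(2)
  by (intro wpI[OF exec.Write]) (auto simp: algebra_simps)

lemma wp_Seq:
  assumes "wp M c1 s (\<lambda>n1 out1 s1. wp M c2 s1 (\<lambda>n2 out2 s2. Q (n1 + n2) (out1 @ out2) s2))"
  shows "wp M (Seq c1 c2) s Q"
proof -
  from assms obtain t1 n1 out1 s1 where 1: "exec c1 s t1 out1 s1" "t1 \<le> n1 * bits M"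
    "wp M c2 s1 (\<lambda>n2 out2 s2. Q (n1 + n2) (out1 @ out2) s2)" by (rule wpE)
  from 1(3) obtain t2 n2 out2 s2 where 2: "exec c2 s1 t2 out2 s2" "t2 \<le> n2 * bits M"
    "Q (n1 + n2) (out1 @ out2) s2" by (rule wpE)
  show ?thesis
    using 1(2) 2(2,3) by (intro wpI[OF exec.Seq[OF 1(1) 2(1)]]) (auto simp: algebra_simps)
qed

lemma wp_Cond:
  assumes b: "bounded_by M b s"
    and "aval b s \<noteq> 0 \<Longrightarrow> wp M c1 s (\<lambda>n. Q (expr_size b + n))"
    and "aval b s = 0 \<Longrightarrow> wp M c2 s (\<lambda>n. Q (expr_size b + n))"
  shows "wp M (Cond b c1 c2) s Q"
proof (cases "aval b s = 0")
  case True
  with assms obtain t n out s' where c: "exec c2 s t out s'" "t \<le> n * bits M"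
    "Q (expr_size b + n) out s'" by (blast elim: wpE)
  show ?thesis
    using acost_le[OF b] c(2,3)
    by (intro wpI[OF exec.CondFalse[OF True c(1)]]) (auto simp: algebra_simps)
next
  case False
  with assms obtain t n out s' where c: "exec c1 s t out s'" "t \<le> n * bits M"
    "Q (expr_size b + n) out s'" by (blast elim: wpE)
  show ?thesis
    using acost_le[OF b] c(2,3)
    by (intro wpI[OF exec.CondTrue[OF False c(1)]]) (auto simp: algebra_simps)
qed

lemma wp_While_step:
  assumes "bounded_by M b s" "aval b s \<noteq> 0"
    and "wp M c s (\<lambda>n1 out1 s1. wp M (While b c) s1
      (\<lambda>n2 out2 s2. Q (expr_size b + n1 + n2) (out1 @ out2) s2))"
  shows "wp M (While b c) s Q"
proof -
  from assms(3) obtain t1 n1 out1 s1 where 1: "exec c s t1 out1 s1" "t1 \<le> n1 * bits M"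
    "wp M (While b c) s1 (\<lambda>n2 out2 s2. Q (expr_size b + n1 + n2) (out1 @ out2) s2)" by (rule wpE)
  from 1(3) obtain t2 n2 out2 s2 where 2: "exec (While b c) s1 t2 out2 s2" "t2 \<le> n2 * bits M"
    "Q (expr_size b + n1 + n2) (out1 @ out2) s2" by (rule wpE)
  show ?thesis
    using acost_le[OF assms(1)] 1(2) 2(2,3)
    by (intro wpI[OF exec.WhileTrue[OF assms(2) 1(1) 2(1)]]) (auto simp: algebra_simps)
qed

lemma wp_While_stop:
  assumes "bounded_by M b s" "aval b s = 0" "Q (expr_size b) [] s"
  shows "wp M (While b c) s Q"
  using acost_le[OF assms(1)] assms(3) by (intro wpI[OF exec.WhileFalse[OF assms(2)]]) auto

text \<open>For loops with a known number of rounds. Indexing the invariant by the completed rounds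
  lets \<open>o_of k\<close> name the output of round k; the induction runs from K downwards over
  the remaining rounds.\<close>

lemma wp_While_count:
  assumes "I 0 s"
    and step: "\<And>k s. k < K \<Longrightarrow> I k s \<Longrightarrow> bounded_by M b s \<and> aval b s \<noteq> 0 \<and>
      wp M c s (\<lambda>n out s'. n \<le> T \<and> out = o_of k \<and> I (Suc k) s')"
    and stop: "\<And>s. I K s \<Longrightarrow> bounded_by M b s \<and> aval b s = 0"
  shows "wp M (While b c) s (\<lambda>n out s'.
    n \<le> K * (T + expr_size b) + expr_size b \<and> out = concat (map o_of [0..<K]) \<and> I K s')"
proof -
  have "wp M (While b c) s (\<lambda>n out s'. n \<le> (K - k) * (T + expr_size b) + expr_size b \<and>
      out = concat (map o_of [k..<K]) \<and> I K s')" if "k \<le> K" "I k s" for k s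
    using that
  proof (induction k arbitrary: s rule: inc_induct)
    case base
    with stop[of s] show ?case by (intro wp_While_stop) auto
  next
    case (step k)
    have count: "(K - k) * u = u + (K - Suc k) * u" for u
      using step(2) Suc_diff_Suc[of k K] by (metis mult_Suc)
    have outs: "concat (map o_of [k..<K]) = o_of k @ concat (map o_of [Suc k..<K])"
      using step(2) by (simp add: upt_conv_Cons)
    from assms(2)[OF step(2,4)] have body: "bounded_by M b s" "aval b s \<noteq> 0"
      "wp M c s (\<lambda>n out s'. n \<le> T \<and> out = o_of k \<and> I (Suc k) s')" by auto
    show ?case
    proof (rule wp_While_step[OF body(1,2) wp_mono[OF body(3)]])
      fix n1 out1 s1
      assume 1: "n1 \<le> T \<and> out1 = o_of k \<and> I (Suc k) s1"
      then show "wp M (While b c) s1 (\<lambda>n2 out2 s2.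
          expr_size b + n1 + n2 \<le> (K - k) * (T + expr_size b) + expr_size b \<and>
          out1 @ out2 = concat (map o_of [k..<K]) \<and> I K s2)"
        unfolding count outs by (intro wp_mono[OF step.IH]) auto
    qed
  qed
  from this[of 0 s] assms(1) show ?thesis by simp
qed

text \<open>For silent loops whose number of rounds depends on the data: it is at most the initial
  measure, as every round lowers the measure by at least 1.\<close>

lemma wp_While_measure:
  assumes "I s"
    and step: "\<And>s. I s \<Longrightarrow> bounded_by M b s \<and>
      (aval b s \<noteq> 0 \<longrightarrow> wp M c s (\<lambda>n out s'. n \<le> T \<and> out = [] \<and> I s' \<and> \<mu> s' < \<mu> s))"
  shows "wp M (While b c) s (\<lambda>n out s'.
    n \<le> \<mu> s * (T + expr_size b) + expr_size b \<and> out = [] \<and> I s' \<and> aval b s' = 0)"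
  using assms(1)
proof (induction "\<mu> s" arbitrary: s rule: less_induct)
  case less
  show ?case
  proof (cases "aval b s = 0")
    case True
    with step[OF less.prems] less.prems show ?thesis by (intro wp_While_stop) auto
  next
    case False
    with step[OF less.prems] have body: "bounded_by M b s"
      "wp M c s (\<lambda>n out s'. n \<le> T \<and> out = [] \<and> I s' \<and> \<mu> s' < \<mu> s)" by auto
    show ?thesis
    proof (rule wp_While_step[OF body(1) False wp_mono[OF body(2)]])
      fix n1 and out1 :: "nat list" and s1
      assume 1: "n1 \<le> T \<and> out1 = [] \<and> I s1 \<and> \<mu> s1 < \<mu> s"
      have "Suc (\<mu> s1) * (T + expr_size b) \<le> \<mu> s * (T + expr_size b)"
        using 1 by (intro mult_right_mono) auto
      then show "wp M (While b c) s1 (\<lambda>n2 out2 s2.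
          expr_size b + n1 + n2 \<le> \<mu> s * (T + expr_size b) + expr_size b \<and>
          out1 @ out2 = [] \<and> I s2 \<and> aval b s2 = 0)"
        using 1 by (intro wp_mono[OF less.hyps]) auto
    qed
  qed
qed

lemma upd_apply [simp]: "upd s x i v y = (if y = x then (s x)(i := v) else s y)"
  by (simp add: upd_def)

section \<open>The reduction program\<close>

abbreviation Var :: "vname \<Rightarrow> aexp" where
  "Var x \<equiv> Cell x (N 0)"

abbreviation Mod :: "aexp \<Rightarrow> aexp \<Rightarrow> aexp" where
  "Mod a b \<equiv> Minus a (Times (Div a b) b)"

abbreviation Set_var :: "vname \<Rightarrow> aexp \<Rightarrow> com" (infix "::=" 65) where
  "x ::= a \<equiv> Assign x (N 0) a"

notation Seq (infixr ";;" 60)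

declare minus_div_mult_eq_mod [simp]

definition copy_input :: com where
  "copy_input =
    ''P'' ::= N 1;; ''m'' ::= Var ''input'';; ''k'' ::= N 0;;
    While (Minus (Var ''m'') (Var ''k''))
      (Assign ''b'' (Var ''k'') (Cell ''input'' (Plus (Var ''k'') (N 1)));;
       ''P'' ::= Times (Var ''P'') (Cell ''b'' (Var ''k''));;
       ''k'' ::= Plus (Var ''k'') (N 1))"

definition binary_length :: com where
  "binary_length =
    ''L'' ::= N 0;;
    While (Var ''P'') (''P'' ::= Div (Var ''P'') (N 2);; ''L'' ::= Plus (Var ''L'') (N 1))"

definition euclid :: com where
  "euclid =
    ''x'' ::= Cell ''b'' (Var ''i'');; ''y'' ::= Cell ''b'' (Var ''j'');;
    While (Var ''y'')
      (''r'' ::= Mod (Var ''x'') (Var ''y'');; ''x'' ::= Var ''y'';; ''y'' ::= Var ''r'')"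

definition split_pair :: com where
  "split_pair =
    Assign ''b'' (Var ''i'') (Div (Cell ''b'' (Var ''i'')) (Var ''x''));;
    Assign ''b'' (Var ''j'') (Div (Cell ''b'' (Var ''j'')) (Var ''x''));;
    Assign ''b'' (Var ''m'') (Var ''x'');;
    ''m'' ::= Plus (Var ''m'') (N 1)"

definition refine :: com where
  "refine =
    ''i'' ::= N 0;; ''j'' ::= N 1;;
    While (Minus (Var ''m'') (Var ''i''))
      (Cond (Minus (Var ''m'') (Var ''j''))
        (euclid;; Cond (Minus (Var ''x'') (N 1)) split_pair (''j'' ::= Plus (Var ''j'') (N 1)))
        (''i'' ::= Plus (Var ''i'') (N 1);; ''j'' ::= Plus (Var ''i'') (N 1)))"

abbreviation base_elem :: aexp where
  "base_elem \<equiv> Cell ''b'' (Div (Var ''a'') (Var ''L''))"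

text \<open>With truncated subtraction, \<open>q + (2 - q)\<close> is the padded range
  \<open>max q 2\<close>.\<close>

definition write_ranges :: com where
  "write_ranges =
    ''A'' ::= Times (Var ''m'') (Var ''L'');; Write (Var ''A'');; ''a'' ::= N 0;;
    While (Minus (Var ''A'') (Var ''a''))
      (Write (Plus base_elem (Minus (N 2) base_elem));; ''a'' ::= Plus (Var ''a'') (N 1))"

abbreviation period :: aexp where
  "period \<equiv> Cell ''input'' (Plus (Var ''k'') (N 1))"

text \<open>
  The variable \<open>v\<close> runs through the powers of the current base element \<open>q\<close>. By truncated
  subtraction \<open>1 - (p mod v)\<close> tests divisibility and \<open>1 - (2 - q)\<close> tests \<open>q \<ge> 2\<close>.
\<close>

definition write_row :: com where
  "write_row =
    ''a'' ::= N 0;;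
    While (Minus (Var ''A'') (Var ''a''))
      (Cond (Mod (Var ''a'') (Var ''L''))
        (''v'' ::= Times (Var ''v'') base_elem) (''v'' ::= base_elem);;
       Write (Times (Minus (N 1) (Mod period (Var ''v''))) (Minus (N 1) (Minus (N 2) base_elem)));;
       ''a'' ::= Plus (Var ''a'') (N 1))"

definition write_rows :: com where
  "write_rows =
    Write (Var ''input'');; ''k'' ::= N 0;;
    While (Minus (Var ''input'') (Var ''k'')) (write_row;; ''k'' ::= Plus (Var ''k'') (N 1))"

section \<open>Correctness and cost of the program phases\<close>

lemma init_store_input [simp]:
  "init_store ps ''input'' 0 = length ps"
  "k < length ps \<Longrightarrow> init_store ps ''input'' (Suc k) = ps ! k"
  by (simp_all add: init_store_def)

lemma prod_list_pos: "(\<And>p. p \<in> set ps \<Longrightarrow> (0::nat) < p) \<Longrightarrow> 0 < prod_list ps"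
  by (induction ps) auto

lemma prod_list_take_le:
  assumes "\<And>p. p \<in> set ps \<Longrightarrow> (0::nat) < p"
  shows "prod_list (take k ps) \<le> prod_list ps"
proof (rule dvd_imp_le[OF _ prod_list_pos[OF assms]])
  show "prod_list (take k ps) dvd prod_list ps"
    by (metis append_take_drop_id dvd_triv_left prod_list.append)
qed

lemma member_le_prod_list:
  assumes "\<And>p. p \<in> set ps \<Longrightarrow> (0::nat) < p" "p \<in> set ps"
  shows "p \<le> prod_list ps"
  using assms by (intro dvd_imp_le prod_list_pos prod_list_dvd) auto

lemma wp_copy_input:
  assumes pos: "\<And>p. p \<in> set ps \<Longrightarrow> 0 < p" and M: "prod_list ps \<le> M" "length ps < M"
  shows "wp M copy_input (init_store ps) (\<lambda>n out s. n \<le> 100 * (length ps + 1) \<and> out = [] \<and>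
    s ''input'' = init_store ps ''input'' \<and> s ''m'' 0 = length ps \<and> s ''P'' 0 = prod_list ps \<and>
    (\<forall>k<length ps. s ''b'' k = ps ! k))"
proof -
  define I where "I k s \<longleftrightarrow> s ''input'' = init_store ps ''input'' \<and> s ''m'' 0 = length ps \<and> s ''k'' 0 = k \<and>
    s ''P'' 0 = prod_list (take k ps) \<and> (\<forall>h<k. s ''b'' h = ps ! h)" for k and s :: store
  show ?thesis
    unfolding copy_input_def
    apply (intro wp_Seq wp_Assign)
          using M apply auto[6]
    apply (rule wp_mono)
     \<comment> \<open>The value of \<open>T\<close> is a generous round bound for the sizes of the
       expressions in the body, here and in the later loops.\<close>
     apply (rule wp_While_count[where I = I and K = "length ps" and T = 80 and o_of = "\<lambda>_. []"])
       apply (simp add: I_def)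
    subgoal premises prems for k s
    proof -
      have "prod_list (take (Suc k) ps) = prod_list (take k ps) * ps ! k"
        using prems(1) by (simp add: take_Suc_conv_app_nth)
      moreover have "ps ! k \<le> M" "prod_list (take k ps) \<le> M" "prod_list (take (Suc k) ps) \<le> M"
        using prems(1) M(1) member_le_prod_list[OF pos nth_mem[OF prems(1)]] prod_list_take_le[OF pos] 
        by (auto intro: le_trans)
      ultimately show ?thesis
        using prems M unfolding I_def
        apply (intro conjI)
          apply simp
         apply simp
        by (intro wp_Seq wp_Assign) (auto simp: less_Suc_eq)
    qed
    using M by (auto simp: I_def)
qed

lemma wp_binary_length:
  assumes p: "s ''P'' 0 = p" and M: "p \<le> M" "floorlog 2 p \<le> M" "2 \<le> M"
  shows "wp M binary_length s (\<lambda>n out s'. n \<le> 100 * (floorlog 2 p + 1) \<and> out = [] \<and>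
    s' ''L'' 0 = floorlog 2 p \<and> s' ''input'' = s ''input'' \<and> s' ''m'' = s ''m'' \<and> s' ''b'' = s ''b'')"
proof -
  define I where "I k s' \<longleftrightarrow> s' ''L'' 0 = k \<and> s' ''P'' 0 = p div 2 ^ k \<and>
    s' ''input'' = s ''input'' \<and> s' ''m'' = s ''m'' \<and> s' ''b'' = s ''b''" for k and s' :: store
  show ?thesis
    unfolding binary_length_def
    apply (intro wp_Seq wp_Assign)
      using M apply auto[2]
    apply (rule wp_mono)
     apply (rule wp_While_count[where I = I and K = "floorlog 2 p" and T = 80 and o_of = "\<lambda>_. []"])
       apply (simp add: I_def p)
    subgoal premises prems for k s'
    proof -
      have "2 ^ k \<le> p"
        using floorlog_geD[of "Suc k" 2 p] prems(1) by simp
      then have "p div 2 ^ k \<noteq> 0"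
        by (simp add: div_eq_0_iff)
      moreover have "p div 2 ^ k \<le> M"
        using M(1) div_le_dividend le_trans by blast
      ultimately show ?thesis
        using prems M unfolding I_def
        apply (intro conjI)
          apply simp
         apply simp
        apply (intro wp_Seq wp_Assign)
            apply (auto simp: power_Suc2 div_mult2_eq simp del: power_Suc)
        done
    qed
    subgoal for s'
      using floorlog_leD[of 2 p "floorlog 2 p"] by (simp add: I_def)
    by (auto simp: I_def)
qed

lemma floorlog_less_if_double_le:
  assumes "2 * m \<le> n" "0 < n"
  shows "floorlog 2 m < floorlog 2 n"
proof -
  have "floorlog 2 m \<le> floorlog 2 (n div 2)"
    using assms by (intro floorlog_mono) auto
  then show ?thesis using assms compute_floorlog[of 2 n] by simp
qed

text \<open>The measure is the bit length of x * y, plus 1 if x < y. For x \<ge> y the remainder is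
  at most x / 2, so the product at least halves. For x < y the round merely swaps the numbers; the
  product stays and the extra 1 disappears. Hence the number of rounds is linear in the bit length
  of B * B.\<close>

lemma wp_euclid:
  assumes B: "s ''b'' (s ''i'' 0) \<le> B" "s ''b'' (s ''j'' 0) \<le> B" "B \<le> M" "s ''i'' 0 \<le> M" "s ''j'' 0 \<le> M"
    and K: "floorlog 2 (B * B) \<le> K"
  shows "wp M euclid s (\<lambda>n out s'. n \<le> 100 * (K + 2) \<and> out = [] \<and>
    s' ''x'' 0 = gcd (s ''b'' (s ''i'' 0)) (s ''b'' (s ''j'' 0)) \<and>
    (\<forall>v. v \<notin> {''x'', ''y'', ''r''} \<longrightarrow> s' v = s v))"
proof -
  let ?g = "gcd (s ''b'' (s ''i'' 0)) (s ''b'' (s ''j'' 0))"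
  define I where "I s' \<longleftrightarrow> gcd (s' ''x'' 0) (s' ''y'' 0) = ?g \<and> s' ''x'' 0 \<le> B \<and> s' ''y'' 0 \<le> B \<and>
    (\<forall>v. v \<notin> {''x'', ''y'', ''r''} \<longrightarrow> s' v = s v)" for s' :: store
  define \<mu> where "\<mu> s' = floorlog 2 (s' ''x'' 0 * s' ''y'' 0) +
    (if s' ''x'' 0 < s' ''y'' 0 then 1 else 0)" for s' :: store
  have \<mu>_le: "\<mu> s' \<le> K + 1" if "I s'" for s'
  proof -
    have "s' ''x'' 0 * s' ''y'' 0 \<le> B * B"
      using that by (intro mult_le_mono) (auto simp: I_def)
    then have "floorlog 2 (s' ''x'' 0 * s' ''y'' 0) \<le> K"
      using K by (meson floorlog_mono le_trans)
    then show ?thesis by (simp add: \<mu>_def)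
  qed
  have decrease: "floorlog 2 (y * (x mod y)) + (if y < x mod y then 1 else 0) <
      floorlog 2 (x * y) + (if x < y then 1 else 0)" if "0 < y" for x y :: nat
  proof (cases "x < y")
    case False
    have "x mod y < y" using that by simp
    moreover have "y + x mod y \<le> x"
      using False that mult_le_mono1[of 1 "x div y" y] div_greater_zero_iff[of x y]
      by (metis One_nat_def Suc_leI add_le_mono1 div_mult_mod_eq not_less nat_mult_1)
    ultimately have "2 * (x mod y) \<le> x" by linarith
    then have "2 * (y * (x mod y)) \<le> x * y"
      using mult_le_mono2[of _ x y] by (simp add: ac_simps)
    then show ?thesis
      using floorlog_less_if_double_le[of "y * (x mod y)" "x * y"] that False
      by (simp add: less_not_sym[OF mod_less_divisor])
  qed (simp add: mult.commute)
  show ?thesis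
    unfolding euclid_def
    apply (intro wp_Seq wp_Assign)
        using B apply auto[4]
    apply (rule wp_mono)
     apply (rule wp_While_measure[where I = I and \<mu> = \<mu> and T = 60])
      using B apply (simp add: I_def)
    subgoal premises prems for s'
    proof -
      define x y where "x = s' ''x'' 0" and "y = s' ''y'' 0"
      note defs = x_def[symmetric] y_def[symmetric]
      have xy: "x \<le> B" "y \<le> B" "gcd x y = ?g" "\<And>v. v \<notin> {''x'', ''y'', ''r''} \<Longrightarrow> s' v = s v"
        using prems by (auto simp: I_def defs)
      have le: "x \<le> M" "y \<le> M" "x div y * y \<le> M" "x div y \<le> M" "x mod y \<le> M" "x mod y \<le> B"
        using xy(1,2) B(3) div_times_less_eq_dividend[of x y] mod_less_eq_dividend[of x y]
          div_le_dividend[of x y] by linarith+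
      have "gcd y (x mod y) = ?g" using xy(3) by (metis gcd_red_nat)
      moreover have "s' ''y'' 0 \<noteq> 0 \<Longrightarrow> \<mu> (upd (upd (upd s' ''r'' 0 (x mod y)) ''x'' 0 y) ''y'' 0 (x mod y)) < \<mu> s'"
        using decrease[of y x] by (simp add: \<mu>_def defs)
      ultimately show ?thesis
        using le(1-5)
        apply (intro conjI impI)
         apply (simp add: defs)
        apply (intro wp_Seq wp_Assign)
        apply (simp_all add: defs)
        using xy(2,4) le(6) by (simp add: I_def)
    qed
    subgoal premises prems for n out s'
    proof -
      let ?s = "upd (upd s ''x'' 0 (s ''b'' (s ''i'' 0))) ''y'' 0 (s ''b'' (s ''j'' 0))"
      have "I ?s" using B by (simp add: I_def)
      \<comment> \<open>63 is the body bound 60 plus the size 3 of the loop test.\<close>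
      from \<mu>_le[OF this] have "\<mu> ?s * 63 \<le> (K + 1) * 63" by (rule mult_le_mono1)
      with prems have "n \<le> (K + 1) * 63 + 3" by simp
      moreover have "I s'" "s' ''y'' 0 = 0" "out = []" using prems by simp_all
      ultimately show ?thesis by (simp add: I_def)
    qed
    done
qed

lemma wp_refine:
  assumes pos: "\<And>p. p \<in> set ps \<Longrightarrow> 0 < p"
    and s: "s ''m'' 0 = length ps" "\<And>k. k < length ps \<Longrightarrow> s ''b'' k = ps ! k"
    and K: "prod_list ps \<le> 2 ^ K" and X: "X = length ps + K" and M: "prod_list ps \<le> M" "X + 2 \<le> M"
  shows "wp M refine s (\<lambda>n out s'.
    n \<le> ((X + 1) * (X + 3)) * (100 * (2 * K + 5)) + 100 \<and> out = [] \<and>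
    (\<exists>j. refinement ps (s' ''m'' 0) (s' ''b'') (s' ''m'' 0) j) \<and>
    s' ''input'' = s ''input'' \<and> s' ''L'' = s ''L'')"
proof -
  define I where "I s' \<longleftrightarrow> refinement ps (s' ''m'' 0) (s' ''b'') (s' ''i'' 0) (s' ''j'' 0) \<and>
    s' ''input'' = s ''input'' \<and> s' ''L'' = s ''L''" for s' :: store
  \<comment> \<open>A split raises m and keeps i and j; a coprime pair raises j. When i advances, j
    may fall back, but the term for j stays below X + 2, the weight of one step of i.\<close>
  define \<mu> where "\<mu> s' = (X - s' ''m'' 0) + (X - s' ''i'' 0) * (X + 2) + (X + 1 - s' ''j'' 0)"
    for s' :: store
  have K': "floorlog 2 (prod_list ps * prod_list ps) \<le> 2 * K + 1"
  proof (rule floorlog_leI)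
    have "prod_list ps * prod_list ps \<le> 2 ^ K * 2 ^ K"
      using K by (rule mult_le_mono[OF _ K])
    also have "\<dots> < 2 ^ (2 * K + 1)" by (simp add: mult_2 power_add)
    finally show "prod_list ps * prod_list ps < 2 ^ (2 * K + 1)" .
  qed auto
  have m_le: "m \<le> X" if "refinement ps m b i j" for m b i j
  proof -
    have "2 ^ (m - length ps) \<le> (2 :: nat) ^ K"
      using refinement_bounds(2)[OF that] K by (rule le_trans)
    then show ?thesis by (simp add: X)
  qed
  let ?T = "100 * (2 * K + 4)"
  have body: "wp M (Cond (Minus (Var ''m'') (Var ''j''))
        (euclid;; Cond (Minus (Var ''x'') (N 1)) split_pair (''j'' ::= Plus (Var ''j'') (N 1)))
        (''i'' ::= Plus (Var ''i'') (N 1);; ''j'' ::= Plus (Var ''i'') (N 1))) s'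
      (\<lambda>n out s''. n \<le> ?T \<and> out = [] \<and> I s'' \<and> \<mu> s'' < \<mu> s')"
    if I: "I s'" and less: "s' ''i'' 0 < s' ''m'' 0" for s'
  proof -
    define m i j b where "m = s' ''m'' 0" and "i = s' ''i'' 0" and "j = s' ''j'' 0" and "b = s' ''b''"
    note defs = m_def[symmetric] i_def[symmetric] j_def[symmetric] b_def[symmetric]
    have r: "refinement ps m b i j" using I by (simp add: I_def defs)
    have ij: "i < j" "j \<le> Suc m" "i < m" using r less by (auto simp: refinement_def defs)
    have X: "m \<le> X" using m_le[OF r] .
    have b_le: "b k \<le> prod_list ps" if "k < m" for k using refinement_bounds(1)[OF r that] .
    show ?thesis
    proof (rule wp_Cond)
      show "bounded_by M (Minus (Var ''m'') (Var ''j'')) s'"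
        using X M ij by (simp add: defs)
    next
      assume "aval (Minus (Var ''m'') (Var ''j'')) s' = 0"
      then have "m \<le> j" by (simp add: defs)
      from refinement_next_i[OF r ij(3) this]
      have "refinement ps m b (Suc i) (Suc (Suc i))" .
      moreover have "(X - Suc i) * (X + 2) + (X + 2) = (X - i) * (X + 2)"
        using ij X by (metis Suc_diff_Suc less_le_trans mult_Suc add.commute)
      ultimately show "wp M (''i'' ::= Plus (Var ''i'') (N 1);; ''j'' ::= Plus (Var ''i'') (N 1)) s'
          (\<lambda>n out s''. expr_size (Minus (Var ''m'') (Var ''j'')) + n \<le> ?T \<and> out = [] \<and>
             I s'' \<and> \<mu> s'' < \<mu> s')"
        using I ij X M \<open>m \<le> j\<close>
        by (intro wp_Seq wp_Assign) (auto simp: I_def \<mu>_def defs)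
    next
      assume "aval (Minus (Var ''m'') (Var ''j'')) s' \<noteq> 0"
      then have "j < m" by (simp add: defs)
      have "wp M euclid s' (\<lambda>n out s''. n \<le> 100 * (2 * K + 1 + 2) \<and> out = [] \<and>
          s'' ''x'' 0 = gcd (s' ''b'' (s' ''i'' 0)) (s' ''b'' (s' ''j'' 0)) \<and>
          (\<forall>v. v \<notin> {''x'', ''y'', ''r''} \<longrightarrow> s'' v = s' v))"
        using b_le[of i] b_le[of j] X M ij \<open>j < m\<close>
        by (intro wp_euclid[OF _ _ M(1) _ _ K']) (auto simp: defs)
      then show "wp M (euclid;; Cond (Minus (Var ''x'') (N 1)) split_pair (''j'' ::= Plus (Var ''j'') (N 1))) s'
          (\<lambda>n out s''. expr_size (Minus (Var ''m'') (Var ''j'')) + n \<le> ?T \<and> out = [] \<and>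
             I s'' \<and> \<mu> s'' < \<mu> s')"
      proof (intro wp_Seq, elim wp_mono)
        fix n and out :: "nat list" and s1
        define g where "g = gcd (b i) (b j)"
        assume "n \<le> 100 * (2 * K + 1 + 2) \<and> out = [] \<and>
          s1 ''x'' 0 = gcd (s' ''b'' (s' ''i'' 0)) (s' ''b'' (s' ''j'' 0)) \<and>
          (\<forall>v. v \<notin> {''x'', ''y'', ''r''} \<longrightarrow> s1 v = s' v)"
        then have n: "n \<le> 100 * (2 * K + 3)" "out = []" and x: "s1 ''x'' 0 = g"
          and frame: "s1 ''m'' = s' ''m''" "s1 ''i'' = s' ''i''" "s1 ''j'' = s' ''j''" "s1 ''b'' = s' ''b''"
            "s1 ''input'' = s' ''input''" "s1 ''L'' = s' ''L''"
          by (auto simp: g_def defs)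
        have g: "g \<le> M" "0 < g"
        proof -
          have "0 < b i" using r ij by (simp add: refinement_def)
          then have "g \<le> b i" "0 < g" by (simp_all add: g_def dvd_imp_le)
          then show "g \<le> M" "0 < g" using b_le[of i] M(1) ij by auto
        qed
        show "wp M (Cond (Minus (Var ''x'') (N 1)) split_pair (''j'' ::= Plus (Var ''j'') (N 1))) s1
            (\<lambda>n2 out2 s2. expr_size (Minus (Var ''m'') (Var ''j'')) + (n + n2) \<le> ?T \<and>
               out @ out2 = [] \<and> I s2 \<and> \<mu> s2 < \<mu> s')"
        proof (rule wp_Cond)
          show "bounded_by M (Minus (Var ''x'') (N 1)) s1" using g M by (simp add: x)
        next
          assume "aval (Minus (Var ''x'') (N 1)) s1 = 0"
          then have "g = 1" using g(2) by (simp add: x)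
          then have "coprime (b i) (b j)" by (simp add: g_def coprime_iff_gcd_eq_1)
          from refinement_next_j[OF r \<open>j < m\<close> this]
          show "wp M (''j'' ::= Plus (Var ''j'') (N 1)) s1 (\<lambda>n2 out2 s2.
              expr_size (Minus (Var ''m'') (Var ''j'')) + (n + (expr_size (Minus (Var ''x'') (N 1)) + n2)) \<le> ?T \<and>
              out @ out2 = [] \<and> I s2 \<and> \<mu> s2 < \<mu> s')"
            using I X M n \<open>j < m\<close> by (intro wp_Assign) (auto simp: frame I_def \<mu>_def defs)
        next
          assume "aval (Minus (Var ''x'') (N 1)) s1 \<noteq> 0"
          then have "1 < g" by (simp add: x)
          from refinement_split[OF r \<open>j < m\<close> g_def this]
          have r': "refinement ps (Suc m) (b(i := b i div g, j := b j div g, m := g)) i j" .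
          \<comment> \<open>The bound on m is applied to the state after the split: only this makes
            X - m strictly decrease.\<close>
          have "Suc m \<le> X" using m_le[OF r'] .
          moreover have "b i \<le> M" "b j \<le> M" using b_le[of i] b_le[of j] ij M \<open>j < m\<close> by auto
          ultimately show "wp M split_pair s1 (\<lambda>n2 out2 s2.
              expr_size (Minus (Var ''m'') (Var ''j'')) + (n + (expr_size (Minus (Var ''x'') (N 1)) + n2)) \<le> ?T \<and>
              out @ out2 = [] \<and> I s2 \<and> \<mu> s2 < \<mu> s')"
            unfolding split_pair_def
            using I X M n \<open>j < m\<close> g ij(1) less_imp_neq[OF ij(1)] r'
            by (intro wp_Seq wp_Assign)
              (auto simp: frame I_def \<mu>_def defs x fun_upd_same fun_upd_other simp del: fun_upd_apply)
        qed
      qed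
    qed
  qed
  have \<mu>_le: "\<mu> s' \<le> (X + 1) * (X + 3)" if "s' ''i'' 0 = 0" for s'
    by (simp add: \<mu>_def that algebra_simps)
  have I0: "I (upd (upd s ''i'' 0 0) ''j'' 0 1)"
    using refinement_init[OF pos, of ps "s ''b''"] s by (simp add: I_def)
  show ?thesis
    unfolding refine_def
    apply (intro wp_Seq wp_Assign)
        using M apply auto[4]
    apply (rule wp_mono)
     apply (rule wp_While_measure[where I = I and \<mu> = \<mu> and T = ?T])
      using I0 apply simp
    subgoal premises prems for s'
    proof -
      have "refinement ps (s' ''m'' 0) (s' ''b'') (s' ''i'' 0) (s' ''j'' 0)"
        using prems by (simp add: I_def)
      then have "s' ''m'' 0 \<le> X" "s' ''i'' 0 \<le> s' ''m'' 0"
        using m_le by (auto simp: refinement_def)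
      then show ?thesis using body[OF prems] M by simp
    qed
    subgoal premises prems for n out s'
    proof -
      \<comment> \<open>The failed test gives m \<le> i and the invariant i \<le> m. With i = m all
        rows are complete, so the base is pairwise coprime.\<close>
      have "s' ''i'' 0 = s' ''m'' 0" using prems by (auto simp: I_def refinement_def)
      moreover have "\<mu> (upd (upd s ''i'' 0 0) ''j'' 0 1) * (?T + 8) \<le> ((X + 1) * (X + 3)) * (100 * (2 * K + 5))"
        by (intro mult_le_mono \<mu>_le) auto
      ultimately show ?thesis using prems by (auto simp: I_def)
    qed
    done
qed

lemma wp_write_ranges:
  assumes s: "s ''m'' 0 = m" "s ''L'' 0 = L" and M: "m * L \<le> M" "m \<le> M" "L \<le> M" "2 \<le> M"
    and b: "\<And>k. k < m \<Longrightarrow> s ''b'' k \<le> M"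
  shows "wp M write_ranges s (\<lambda>n out s'. n \<le> 100 * (m * L + 1) \<and>
    out = m * L # map (\<lambda>a. max (s ''b'' (a div L)) 2) [0..<m * L] \<and>
    s' ''A'' 0 = m * L \<and> s' ''input'' = s ''input'' \<and> s' ''L'' = s ''L'' \<and> s' ''b'' = s ''b'')"
proof -
  define I where "I a s' \<longleftrightarrow> s' ''a'' 0 = a \<and> s' ''A'' 0 = m * L \<and>
    s' ''input'' = s ''input'' \<and> s' ''L'' = s ''L'' \<and> s' ''b'' = s ''b''" for a and s' :: store
  show ?thesis
    unfolding write_ranges_def
    apply (intro wp_Seq wp_Assign wp_Write)
         using M s apply auto[5]
    apply (rule wp_mono)
     apply (rule wp_While_count[where I = I and K = "m * L" and T = 80
        and o_of = "\<lambda>a. [max (s ''b'' (a div L)) 2]"])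
       using s apply (simp add: I_def)
    subgoal premises prems for a s'
    proof -
      have "s ''b'' (a div L) \<le> M" using b prems(1) by (simp add: less_mult_imp_div_less)
      moreover have "a div L \<le> M" using prems(1) M(1) div_le_dividend[of a L] by linarith
      ultimately show ?thesis
        using prems M s unfolding I_def
        apply (intro conjI)
          apply simp
         apply simp
        by (intro wp_Seq wp_Assign wp_Write) auto
    qed
    using M s by (auto simp: I_def concat_map_singleton)
qed

lemma wp_write_row:
  assumes s: "s ''A'' 0 = m * L" "s ''L'' 0 = L" "s ''input'' (Suc (s ''k'' 0)) = p"
    and M: "m * L \<le> M" "L \<le> M" "2 \<le> M" "p \<le> M" "Suc (s ''k'' 0) \<le> M"
    and b: "\<And>k. k < m \<Longrightarrow> 0 < s ''b'' k" "\<And>k l. k < m \<Longrightarrow> l \<le> L \<Longrightarrow> s ''b'' k ^ l \<le> M"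
    and p: "0 < p"
  shows "wp M write_row s (\<lambda>n out s'. n \<le> 200 * (m * L + 1) \<and>
    out = map (\<lambda>a. if 2 \<le> s ''b'' (a div L) \<and> s ''b'' (a div L) ^ Suc (a mod L) dvd p then 1 else 0)
      [0..<m * L] \<and>
    s' ''A'' = s ''A'' \<and> s' ''k'' = s ''k'' \<and> s' ''input'' = s ''input'' \<and> s' ''L'' = s ''L'' \<and>
    s' ''b'' = s ''b'')"
proof -
  let ?q = "\<lambda>a. s ''b'' (a div L)"
  \<comment> \<open>At the start of a block of L attributes \<open>v\<close> is stale and about to
    be reset, so the invariant describes it only inside a block.\<close>
  define I where "I a s' \<longleftrightarrow> s' ''a'' 0 = a \<and>
    (a mod L \<noteq> 0 \<longrightarrow> s' ''v'' 0 = ?q a ^ (a mod L)) \<and>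
    s' ''A'' = s ''A'' \<and> s' ''k'' = s ''k'' \<and> s' ''input'' = s ''input'' \<and> s' ''L'' = s ''L'' \<and>
    s' ''b'' = s ''b''" for a and s' :: store
  show ?thesis
    unfolding write_row_def
    apply (intro wp_Seq wp_Assign)
      using M s apply auto[2]
    apply (rule wp_mono)
     apply (rule wp_While_count[where I = I and K = "m * L" and T = 180
        and o_of = "\<lambda>a. [if 2 \<le> ?q a \<and> ?q a ^ Suc (a mod L) dvd p then 1 else 0]"])
       using s apply (simp add: I_def)
    subgoal premises prems for a s'
    proof -
      have a: "a div L < m" "0 < L" "a mod L < L"
        using prems(1) by (auto simp: less_mult_imp_div_less intro!: mod_less_divisor gr0I)
      have "?q a ^ 1 \<le> M" "?q a ^ (a mod L) \<le> M" and v: "?q a ^ Suc (a mod L) \<le> M"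
        using a by (intro b(2); simp)+
      then have q: "?q a \<le> M" "0 < ?q a" using b(1) a by auto
      have le: "a div L \<le> M" "a div L * L \<le> M" "p div x * x \<le> M" for x
        using prems(1) M(1,4) div_le_dividend[of a L] div_times_less_eq_dividend[of a L]
          div_times_less_eq_dividend[of p x] by linarith+
      have "(1 - p mod x) * (1 - (2 - ?q a)) = (if 2 \<le> ?q a \<and> x dvd p then 1 else 0)" for x
        using q(2) by (auto simp: dvd_eq_mod_eq_0)
      note out = this[of "?q a ^ Suc (a mod L)"]
      \<comment> \<open>Unless a block ends at a, the next attribute has the same base element and
        the next digit position.\<close>
      have next_v: "?q (Suc a) = ?q a" "Suc a mod L = Suc (a mod L)" if "Suc a mod L \<noteq> 0"
        using that by (auto simp: div_Suc mod_Suc split: if_splits)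
      have small: "(1 - x) * (1 - y) \<le> M" for x y
        using M(3) mult_le_mono[of "1 - x" 1 "1 - y" 1] by simp
      have step: "wp M (Write (Times (Minus (N 1) (Mod period (Var ''v''))) (Minus (N 1) (Minus (N 2) base_elem)));;
          ''a'' ::= Plus (Var ''a'') (N 1)) s1 (\<lambda>n out s2. n \<le> 70 \<and>
          out = [if 2 \<le> ?q a \<and> ?q a ^ Suc (a mod L) dvd p then 1 else 0] \<and> I (Suc a) s2)"
        if "s1 = upd s' ''v'' 0 (?q a ^ Suc (a mod L))" for s1
        using prems M s q v le out next_v small unfolding that I_def
        by (intro wp_Seq wp_Assign wp_Write) (auto simp del: power_Suc)
      have guard: "bounded_by M (Minus (Var ''A'') (Var ''a'')) s'"
          "aval (Minus (Var ''A'') (Var ''a'')) s' \<noteq> 0"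
        using prems M s by (simp_all add: I_def)
      have v_eq: "s' ''v'' 0 * ?q a = ?q a ^ Suc (a mod L)" if "a mod L \<noteq> 0"
        using prems(2) that by (simp add: I_def)
      have "wp M (Cond (Mod (Var ''a'') (Var ''L''))
          (''v'' ::= Times (Var ''v'') base_elem) (''v'' ::= base_elem)) s'
          (\<lambda>n out s1. n \<le> 100 \<and> out = [] \<and> s1 = upd s' ''v'' 0 (?q a ^ Suc (a mod L)))"
        using prems M s q v le v_eq \<open>?q a ^ (a mod L) \<le> M\<close> unfolding I_def
        by (intro wp_Cond wp_Assign) (auto simp del: power_Suc)
      then have "wp M (Cond (Mod (Var ''a'') (Var ''L''))
          (''v'' ::= Times (Var ''v'') base_elem) (''v'' ::= base_elem);;
          Write (Times (Minus (N 1) (Mod period (Var ''v''))) (Minus (N 1) (Minus (N 2) base_elem)));;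
          ''a'' ::= Plus (Var ''a'') (N 1)) s' (\<lambda>n out s2. n \<le> 180 \<and>
          out = [if 2 \<le> ?q a \<and> ?q a ^ Suc (a mod L) dvd p then 1 else 0] \<and> I (Suc a) s2)"
        by (intro wp_Seq, elim wp_mono conjE, intro wp_mono[OF step]) simp_all
      with guard show ?thesis by blast
    qed
    using M s by (auto simp: I_def concat_map_singleton)
qed

lemma wp_write_rows:
  assumes s: "s ''A'' 0 = m * L" "s ''L'' 0 = L" "s ''input'' = init_store ps ''input''"
    and M: "m * L \<le> M" "L \<le> M" "2 \<le> M" "\<And>p. p \<in> set ps \<Longrightarrow> p \<le> M" "length ps \<le> M"
    and b: "\<And>k. k < m \<Longrightarrow> 0 < s ''b'' k" "\<And>k l. k < m \<Longrightarrow> l \<le> L \<Longrightarrow> s ''b'' k ^ l \<le> M"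
    and pos: "\<And>p. p \<in> set ps \<Longrightarrow> 0 < p"
  shows "wp M write_rows s (\<lambda>n out s'. n \<le> (length ps + 1) * (200 * (m * L + 2)) \<and>
    out = length ps # concat (map (\<lambda>p. map (\<lambda>a. if 2 \<le> s ''b'' (a div L) \<and>
      s ''b'' (a div L) ^ Suc (a mod L) dvd p then 1 else 0) [0..<m * L]) ps))"
proof -
  let ?row = "\<lambda>p. map (\<lambda>a. if 2 \<le> s ''b'' (a div L) \<and>
      s ''b'' (a div L) ^ Suc (a mod L) dvd p then 1 else 0) [0..<m * L]"
  define I where "I k s' \<longleftrightarrow> s' ''k'' 0 = k \<and> s' ''A'' = s ''A'' \<and>
    s' ''input'' = s ''input'' \<and> s' ''L'' = s ''L'' \<and> s' ''b'' = s ''b''" for k and s' :: store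
  have rows: "concat (map (\<lambda>k. ?row (ps ! k)) [0..<length ps]) = concat (map ?row ps)"
    by (rule arg_cong[of _ _ concat], rule nth_equalityI) simp_all
  show ?thesis
    unfolding write_rows_def
    apply (intro wp_Seq wp_Assign wp_Write)
       using M s apply auto[3]
    apply (rule wp_mono)
     apply (rule wp_While_count[where I = I and K = "length ps" and T = "200 * (m * L + 1) + 50"
        and o_of = "\<lambda>k. ?row (ps ! k)"])
       using s apply (simp add: I_def)
    subgoal premises prems for k s'
    proof -
      have p: "ps ! k \<in> set ps" using prems(1) by simp
      have "wp M write_row s' (\<lambda>n out s''. n \<le> 200 * (m * L + 1) \<and> out =
          map (\<lambda>a. if 2 \<le> s' ''b'' (a div L) \<and> s' ''b'' (a div L) ^ Suc (a mod L) dvd ps ! k then 1 else 0)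
          [0..<m * L] \<and> s'' ''A'' = s' ''A'' \<and> s'' ''k'' = s' ''k'' \<and> s'' ''input'' = s' ''input'' \<and>
          s'' ''L'' = s' ''L'' \<and> s'' ''b'' = s' ''b'')"
        using prems s M(4)[OF p] M pos[OF p] b by (intro wp_write_row) (auto simp: I_def)
      then have "wp M (write_row;; ''k'' ::= Plus (Var ''k'') (N 1)) s'
          (\<lambda>n out s''. n \<le> 200 * (m * L + 1) + 50 \<and> out = ?row (ps ! k) \<and> I (Suc k) s'')"
        using prems M by (intro wp_Seq, elim wp_mono, intro wp_Assign) (auto simp: I_def)
      then show ?thesis using prems M s by (auto simp: I_def)
    qed
    subgoal for s' using M s by (simp add: I_def)
    subgoal unfolding rows using s(3) by (auto simp: algebra_simps)
    done
qed

section \<open>Assembling the reduction\<close>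

text \<open>The encoding is grouped as the two writing phases produce it: number of attributes and
  ranges, then number of symbols and rows.\<close>

lemma pcp_encode_base_pcp:
  "pcp_encode (base_pcp m L q ps) =
    (m * L # map (\<lambda>a. max (q (a div L)) 2) [0..<m * L]) @
    length ps # concat (map (\<lambda>p. map (\<lambda>a. if 2 \<le> q (a div L) \<and> q (a div L) ^ Suc (a mod L) dvd p
      then 1 else 0) [0..<m * L]) ps)"
  by (auto simp: pcp_encode_def base_pcp_def intro!: arg_cong[of _ _ concat])

definition reduction :: com where
  "reduction = copy_input;; binary_length;; refine;; write_ranges;; write_rows"

text \<open>Over polynomials as well as numbers, to yield the time bound as a polynomial.\<close>

definition reduction_steps :: "'a :: comm_semiring_1 \<Rightarrow> 'a" where
  "reduction_steps S = 100 * (S + 1) + 100 * (S + 2) +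
     ((2 * S + 1) * (2 * S + 3) * (100 * (2 * S + 5)) + 100) +
     100 * (2 * S * (S + 1) + 1) + (S + 1) * (200 * (2 * S * (S + 1) + 2))"

lemma poly_reduction_steps: "poly (reduction_steps [:0, 1:]) S = reduction_steps (S :: nat)"
  by (simp add: reduction_steps_def algebra_simps)

lemma input_size_bounds:
  shows "length ps \<le> input_size ps" "prod_list ps \<le> 2 ^ input_size ps"
proof -
  show "length ps \<le> input_size ps"
    by (induction ps) (auto simp: input_size_def bits_def)
  have le: "p \<le> 2 ^ bits p" for p
    using floorlog_leD[of 2 p "bits p"] by (simp add: bits_def)
  show "prod_list ps \<le> 2 ^ input_size ps"
    by (induction ps) (auto simp: input_size_def power_add intro!: mult_le_mono le)
qed

text \<open>The exponent of the value bound dominates S (S + 1), needed for the powers up to q^L,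
  and 2 S (S + 1), the bound on the number of attributes, as well as all linear terms. The cost unit
  \<open>bits M\<close> is thus quadratic in S.\<close>

lemma wp_reduction:
  assumes pos: "\<And>p. p \<in> set ps \<Longrightarrow> 0 < p" and S: "S = input_size ps"
  shows "wp (2 ^ (2 * S * S + 4 * S + 8)) reduction (init_store ps) (\<lambda>n out s.
    n \<le> reduction_steps S \<and>
    (\<exists>m L b j. out = pcp_encode (base_pcp m L b ps) \<and> refinement ps m b m j \<and> prod_list ps < 2 ^ L))"
proof -
  define E where "E = 2 * S * S + 4 * S + 8"
  define M :: nat where "M = 2 ^ E"
  define L where "L = floorlog 2 (prod_list ps)"
  have n: "length ps \<le> S" and P: "prod_list ps \<le> 2 ^ S"
    using input_size_bounds by (simp_all add: S)
  have M_ge: "x \<le> M" if "x \<le> E" for x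
    unfolding M_def using that by (meson less_exp le_trans less_imp_le)
  have M_pow: "2 ^ x \<le> M" if "x \<le> E" for x
    using that by (simp add: M_def power_increasing)
  have SE: "S \<le> E" "S + 1 \<le> E" "2 * S + 2 \<le> E" "2 \<le> E" "2 * S * (S + 1) \<le> E" "S * (S + 1) \<le> E"
    by (simp_all add: E_def algebra_simps)
  have PM: "prod_list ps \<le> M" using P M_pow[OF SE(1)] by simp
  have L_le: "L \<le> S + 1"
    unfolding L_def by (rule floorlog_leI) (use P in \<open>auto simp: le_less_trans\<close>)
  have L_gt: "prod_list ps < 2 ^ L"
    unfolding L_def by (rule floorlog_leD) auto
  have n_M: "length ps < M" "length ps \<le> M" 
    unfolding M_def using le_less_trans[OF le_trans[OF n SE(1)] less_exp] by simp_all
  have M2: "2 \<le> M" and LM: "L \<le> M" using M_ge SE(2,4) L_le by simp_all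
  have XM: "length ps + S + 2 \<le> M" using M_ge[of "length ps + S + 2"] n SE(3) by simp
  have p_M: "p \<le> M" if "p \<in> set ps" for p
    using member_le_prod_list[OF pos that] PM by simp
  have X: "(length ps + S + 1) * (length ps + S + 3) * (100 * (2 * S + 5)) \<le>
      (2 * S + 1) * (2 * S + 3) * (100 * (2 * S + 5))"
    using n by (intro mult_le_mono) auto
  have "wp M reduction (init_store ps) (\<lambda>n out s.
    n \<le> reduction_steps S \<and>
    (\<exists>m L b j. out = pcp_encode (base_pcp m L b ps) \<and> refinement ps m b m j \<and> prod_list ps < 2 ^ L))"
    unfolding reduction_def
  proof (rule wp_Seq, rule wp_mono[OF wp_copy_input[OF pos PM n_M(1)]], assumption, elim conjE,
      rule wp_Seq, rule wp_mono[OF wp_binary_length], assumption, rule PM, fold L_def, rule LM, rule M2,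
      elim conjE, rule wp_Seq, rule wp_mono[OF wp_refine[OF pos _ _ P refl PM XM]], assumption,
      simp, simp, elim conjE exE)
    fix n1 n2 n3 and o1 o2 o3 :: "nat list" and s1 s2 s3 :: store and j
    define m b where "m = s3 ''m'' 0" and "b = s3 ''b''"
    assume n1: "n1 \<le> 100 * (length ps + 1)" and n2: "n2 \<le> 100 * (L + 1)"
      and n3: "n3 \<le> (length ps + S + 1) * (length ps + S + 3) * (100 * (2 * S + 5)) + 100"
      and out: "o1 = []" "o2 = []" "o3 = []"
      and s1: "s1 ''input'' = init_store ps ''input''"
      and s2: "s2 ''L'' 0 = L" "s2 ''input'' = s1 ''input''"
      and s3: "refinement ps (s3 ''m'' 0) (s3 ''b'') (s3 ''m'' 0) j"
        "s3 ''input'' = s2 ''input''" "s3 ''L'' = s2 ''L''"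
    have r: "refinement ps m b m j" using s3(1) by (simp add: m_def b_def)
    \<comment> \<open>At most S splits are possible, on top of at most S periods.\<close>
    have "2 ^ (m - length ps) \<le> (2 :: nat) ^ S"
      using refinement_bounds(2)[OF r] P by (rule le_trans)
    then have m: "m \<le> 2 * S" using n by simp
    have "m * L \<le> 2 * S * (S + 1)" using m L_le by (rule mult_le_mono)
    then have mL: "m * L \<le> 2 * S * (S + 1)" "m * L \<le> M" using M_ge[of "m * L"] SE(5) by simp_all
    have mM: "m \<le> M" using M_ge[of m] SE(3) m by simp
    have b_pow: "b k ^ l \<le> M" if "k < m" "l \<le> L" for k l
    proof -
      have "b k ^ l \<le> (2 ^ S) ^ l"
        using refinement_bounds(1)[OF r that(1)] P by (intro power_mono) auto
      also have "\<dots> = 2 ^ (S * l)" by (simp add: power_mult)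
      also have "\<dots> \<le> M"
        using that(2) L_le SE(6) mult_le_mono2[of l "S + 1" S] by (intro M_pow) simp
      finally show ?thesis .
    qed
    have b_le: "b k \<le> M" if "k < m" for k
      using refinement_bounds(1)[OF r that] PM by simp
    have b_pos: "0 < b k" if "k < m" for k
      using r that by (simp add: refinement_def)
    have ranges: "wp M write_ranges s3 (\<lambda>n out s'. n \<le> 100 * (m * L + 1) \<and>
        out = m * L # map (\<lambda>a. max (b (a div L)) 2) [0..<m * L] \<and>
        s' ''A'' 0 = m * L \<and> s' ''input'' = s3 ''input'' \<and> s' ''L'' = s3 ''L'' \<and> s' ''b'' = s3 ''b'')"
      using wp_write_ranges[of s3 m L M] mL mM LM M2 b_le s2(1) s3(3)
      by (simp add: m_def b_def)
    let ?rows = "length ps # concat (map (\<lambda>p. map (\<lambda>a. if 2 \<le> b (a div L) \<and>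
      b (a div L) ^ Suc (a mod L) dvd p then 1 else 0) [0..<m * L]) ps)"
    have rows: "wp M write_rows s4 (\<lambda>n out s'. n \<le> (length ps + 1) * (200 * (m * L + 2)) \<and> out = ?rows)"
      if "s4 ''A'' 0 = m * L" "s4 ''input'' = s3 ''input''" "s4 ''L'' = s3 ''L''" "s4 ''b'' = s3 ''b''" for s4
      using wp_write_rows[of s4 m L ps M] that mL LM M2 p_M n_M b_pos b_pow pos s1 s2 s3
      by (simp add: b_def)
    have n4: "100 * (m * L + 1) \<le> 100 * (2 * S * (S + 1) + 1)"
      "(length ps + 1) * (200 * (m * L + 2)) \<le> (S + 1) * (200 * (2 * S * (S + 1) + 2))"
      by (intro mult_le_mono add_le_mono le_refl n mL(1))+
    show "wp M (write_ranges;; write_rows) s3 (\<lambda>n4 out4 s4.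
        n1 + (n2 + (n3 + n4)) \<le> reduction_steps S \<and>
        (\<exists>m L b j. o1 @ o2 @ o3 @ out4 = pcp_encode (base_pcp m L b ps) \<and>
          refinement ps m b m j \<and> prod_list ps < 2 ^ L))"
    proof (rule wp_Seq, rule wp_mono[OF ranges], elim conjE, rule wp_mono[OF rows], assumption+, elim conjE,
        intro conjI exI)
      fix n4 n5 and o4 o5 :: "nat list"
      assume n45: "n4 \<le> 100 * (m * L + 1)" "n5 \<le> (length ps + 1) * (200 * (m * L + 2))"
        and o4: "o4 = m * L # map (\<lambda>a. max (b (a div L)) 2) [0..<m * L]" "o5 = ?rows"
      have "n1 \<le> 100 * (S + 1)" "n2 \<le> 100 * (S + 2)"
        using n1 n2 n L_le by simp_all
      then have "n1 + n2 + n3 + n4 + n5 \<le> reduction_steps S"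
        unfolding reduction_steps_def
        using le_trans[OF n3 add_le_mono1[OF X]] n45 n4 by (intro add_le_mono) (auto intro: le_trans)
      then show "n1 + (n2 + (n3 + (n4 + n5))) \<le> reduction_steps S"
        by (simp only: add.assoc)
      show "o1 @ o2 @ o3 @ o4 @ o5 = pcp_encode (base_pcp m L b ps)"
        unfolding pcp_encode_base_pcp o4 out by simp
    qed (rule r L_gt)+
  qed
  then show ?thesis unfolding M_def E_def .
qed

theorem theorem1: "poly_time_reducible windows_scheduling partial_coding"
proof -
  define p :: "nat poly" where
    \<comment> \<open>The second factor is the cost unit: the value bound is 2^e with e = 2 S^2 + 4
      S + 8, and \<open>bits (2 ^ e)\<close> is e + 2, for e + 1 digits and the separator.\<close>
    "p = reduction_steps [:0, 1:] * (2 * [:0, 1:] * [:0, 1:] + 4 * [:0, 1:] + 10)"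
  have "\<exists>I. I \<in> pcp_instances \<and>
      (\<exists>t s'. exec reduction (init_store ps) t (pcp_encode I) s' \<and> t \<le> poly p (input_size ps)) \<and>
      ((\<exists>t. feasible_schedule ps t) \<longleftrightarrow> (\<exists>c. feasible_encoding I c))"
    if pos: "\<forall>p\<in>set ps. 0 < p" for ps
  proof -
    define S where "S = input_size ps"
    have bits: "bits (2 ^ e) = e + 2" for e
      using floorlog_power[of 1 2 e] by (simp add: bits_def compute_floorlog)
    from wp_reduction[OF _ S_def] pos obtain t n s m L b j where
      ex: "exec reduction (init_store ps) t (pcp_encode (base_pcp m L b ps)) s"
      and t: "t \<le> n * bits (2 ^ (2 * S * S + 4 * S + 8))"
      and n: "n \<le> reduction_steps S"
      and r: "refinement ps m b m j" and L: "prod_list ps < 2 ^ L"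
      by (blast elim: wpE)
    have "t \<le> n * (2 * S * S + 4 * S + 10)" using t unfolding bits by (simp add: add.commute)
    also have "\<dots> \<le> reduction_steps S * (2 * S * S + 4 * S + 10)"
      using n by (rule mult_le_mono1)
    also have "\<dots> = poly p S"
      by (simp add: p_def poly_reduction_steps algebra_simps del: One_nat_def)
    finally have "t \<le> poly p (input_size ps)" by (simp add: S_def)
    moreover have "(\<exists>t. feasible_schedule ps t) \<longleftrightarrow> (\<exists>c. feasible_encoding (base_pcp m L b ps) c)"
    proof (rule feasible_schedule_iff_base_pcp)
      show "q < 2 ^ L" if "q \<in> set ps" for q
        using member_le_prod_list[OF _ that] pos L by (simp add: le_less_trans)
    qed (use r in \<open>auto simp: refinement_def\<close>)
    ultimately show ?thesis
      using base_pcp_in_instances ex by blast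
  qed
  then have "\<forall>ps\<in>{ps. \<forall>p\<in>set ps. 0 < p}. \<exists>I. I \<in> pcp_instances \<and>
      (\<exists>t s'. exec reduction (init_store ps) t (pcp_encode I) s' \<and> t \<le> poly p (input_size ps)) \<and>
      ((\<exists>t. feasible_schedule ps t) \<longleftrightarrow> (\<exists>c. feasible_encoding I c))"
    by blast
  \<comment> \<open>The base is known only through the final store of the refinement phase, so the
    reducing function is obtained by choice from the instances that the program writes.\<close>
  from bchoice[OF this] show ?thesis
    unfolding poly_time_reducible_def poly_time_computable_def windows_scheduling_def partial_coding_def
    by (simp only: decision_problem.simps) blast
qed

end
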